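(* Let $n\geqslant 1$, $T>0$, and let $q\in L_{1,\mathrm{loc}}([0,\infty);\mathbb M^n_{\mathbb C})$ be Hermitian-valued and such that the minimal Schrödinger operator $L_0$ (defined in the context) is positive definite. Let $f\in C^\infty([0,T];\mathbb C^n)$ with $\operatorname{supp}f\subset(0,T]$, and let $w$ be the kernel associated with $q$ (defined in the context). Then the function $$u^{f}_{\beta}(x,t)=f(t-x)+\int_x^t w(x,s)f(t-s)\,ds,\qquad x\in[0,\infty),\ t\in[0,T],$$ is the solution of the system $$u(\cdot,t)\in\operatorname{Dom}L_0^*,\qquad t\in[0,T],$$ $$\ddot u(x,t)-u_{xx}(x,t)+q(x)u(x,t)=0,\qquad x\in(0,\infty),\ t\in(0,T),$$ $$u(x,0)=\dot u(x,0)=0,\qquad x\in[0,\infty),$$ $$u(0,t)=f(t),\qquad t\in[0,T],$$ where $\dot u,\ddot u$ denote derivatives in $t$ of $u$ regarded as a function of $t$ with values in the Hilbert space $L_2([0,\infty);\mathbb C^n)$, and $u_x,u_{xx}$ denote partial derivatives with respect to $x$ of the function of two variables $u(x,t)$.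
   Context: $\mathbb M^n_{\mathbb C}$ is the space of complex $n\times n$ matrices; $L_{1,\mathrm{loc}}([0,\infty))$ means summable on $[0,R]$ for every $R>0$. $W^2_{1,\mathrm{loc}}([0,\infty);\mathbb C^n)$ is the space of $y$ with $y,y'$ locally absolutely continuous on $[0,\infty)$. Operators in $\mathscr H=L_2([0,\infty);\mathbb C^n)$: $L_{\max}$ and $L_{\min}$ act as $y\mapsto -y''+qy$ on $$\operatorname{Dom}L_{\max}=\{y\in L_2([0,\infty);\mathbb C^n)\cap W^2_{1,\mathrm{loc}}([0,\infty);\mathbb C^n)\,|\,-y''+qy\in L_2([0,\infty);\mathbb C^n)\},$$ $$\operatorname{Dom}L_{\min}=\{y\in\operatorname{Dom}L_{\max}\,|\,\operatorname{supp}y\subset(0,\infty)\text{ is compact}\}.$$ $L_0$ is the closure of $L_{\min}$, and $L_0^*=L_{\max}$. Positive definite means $(L_0y,y)\geqslant c\|y\|^2$ for all $y\in\operatorname{Dom}L_0$ with some $c>0$. The equation is an equality in $\mathscr H$ for every $t\in(0,T)$, i.e. it holds for a.e. $x$. The system is known to have at most one solution. The kernel $w$: let $v(\xi,\eta)$, $0\leqslant\xi\leqslant\eta<\infty$, be the unique continuous $\mathbb M^n_{\mathbb C}$-valued solution of $$v(\xi,\eta)=-\frac12\int_{\xi/2}^{\eta/2}q(s)\,ds-\frac14\int_0^{\xi}d\xi_1\int_{\xi}^{\eta}d\eta_1\,q\Big(\frac{\eta_1-\xi_1}{2}\Big)v(\xi_1,\eta_1),$$ and put $w(x,t):=v(t-x,t+x)$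 for $0\leqslant x\leqslant t<\infty$. The function $f$ is continued to the negative half-line by zero, and for $x>t$ the integral term is taken to be zero, so that $u^f_\beta(x,t)=0$ for $x>t$. *)

theory Defs
  imports "HOL-Analysis.Analysis"
begin

text \<open>
  \<open>C\<^sup>n\<close> is \<^typ>\<open>complex ^ 'n\<close> for an arbitrary finite index type \<open>'n\<close>, and the \<open>n \<times> n\<close> matrices are
  \<^typ>\<open>complex ^ 'n ^ 'n\<close>. Functions on \<open>[0,\<infty>)\<close> are functions on \<^typ>\<open>real\<close> of which only the values
  on \<open>{0..}\<close> are used.
\<close>

section \<open>Assumptions on the potential\<close>

definition hermitian :: "complex ^ 'n ^ 'n \<Rightarrow> bool" where
  "hermitian A \<longleftrightarrow> (\<forall>i j. A $ i $ j = cnj (A $ j $ i))"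

definition L1_loc :: "(real \<Rightarrow> 'a::euclidean_space) \<Rightarrow> bool" where
  "L1_loc q \<longleftrightarrow> (\<forall>R>0. q absolutely_integrable_on {0..R})"

section \<open>The space \<open>L\<^sub>2([0,\<infty>); C\<^sup>n)\<close>\<close>

text \<open>
  Elements of \<open>L\<^sub>2\<close> are represented by functions; equality in \<open>L\<^sub>2\<close> is equality almost everywhere
  with respect to \<^term>\<open>lebesgue_on {0::real..}\<close>.
\<close>

definition L2 :: "(real \<Rightarrow> complex ^ 'n) set" where
  "L2 = {y. y \<in> borel_measurable (lebesgue_on {0..}) \<and>
            integrable (lebesgue_on {0..}) (\<lambda>x. (norm (y x))\<^sup>2)}"

definition L2_norm :: "(real \<Rightarrow> complex ^ 'n) \<Rightarrow> real" where
  "L2_norm y = sqrt (\<integral>x. (norm (y x))\<^sup>2 \<partial>lebesgue_on {0..})"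

definition L2_inner :: "(real \<Rightarrow> complex ^ 'n) \<Rightarrow> (real \<Rightarrow> complex ^ 'n) \<Rightarrow> complex" where
  "L2_inner y z = (\<integral>x. (\<Sum>i\<in>UNIV. y x $ i * cnj (z x $ i)) \<partial>lebesgue_on {0..})"

definition has_L2_derivative ::
  "(real \<Rightarrow> real \<Rightarrow> complex ^ 'n) \<Rightarrow> (real \<Rightarrow> complex ^ 'n) \<Rightarrow> real \<Rightarrow> real set \<Rightarrow> bool" where
  "has_L2_derivative U D t S \<longleftrightarrow> D \<in> L2 \<and>
     ((\<lambda>s. L2_norm (\<lambda>x. (1 / (s - t)) *\<^sub>R (U s x - U t x) - D x)) \<longlongrightarrow> 0) (at t within S)"

section \<open>The space \<open>W\<^sup>2\<^sub>1\<^sub>,\<^sub>l\<^sub>o\<^sub>c\<close> and the Schroedinger operators\<close>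

definition absolutely_continuous_on ::
  "real \<Rightarrow> real \<Rightarrow> (real \<Rightarrow> 'a::real_normed_vector) \<Rightarrow> bool" where
  "absolutely_continuous_on A B y \<longleftrightarrow>
     (\<forall>\<epsilon>>0. \<exists>\<delta>>0. \<forall>(N::nat) a b.
        (\<forall>k<N. A \<le> a k \<and> a k \<le> b k \<and> b k \<le> B) \<and>
        pairwise (\<lambda>j k. {a j<..<b j} \<inter> {a k<..<b k} = {}) {..<N} \<and>
        (\<Sum>k<N. b k - a k) < \<delta> \<longrightarrow>
        (\<Sum>k<N. norm (y (b k) - y (a k))) < \<epsilon>)"

definition locally_AC :: "(real \<Rightarrow> 'a::real_normed_vector) \<Rightarrow> bool" where
  "locally_AC y \<longleftrightarrow> (\<forall>R>0. absolutely_continuous_on 0 R y)"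

text \<open>The derivative in \<open>x \<in> [0,\<infty>)\<close>, one-sided at \<open>0\<close>; unspecified where it does not exist.\<close>

definition dx :: "(real \<Rightarrow> 'a::real_normed_vector) \<Rightarrow> real \<Rightarrow> 'a" where
  "dx y x = vector_derivative y (at x within {0..})"

definition W21_loc :: "(real \<Rightarrow> complex ^ 'n) set" where
  "W21_loc = {y. locally_AC y \<and> (\<forall>x\<ge>0. y differentiable (at x within {0..})) \<and> locally_AC (dx y)}"

text \<open>
  For \<open>y \<in> W21_loc\<close> the second derivative \<open>dx (dx y)\<close> exists almost everywhere on \<open>[0,\<infty>)\<close>, so the
  unspecified values on the exceptional null set do not matter.
\<close>

definition schroedinger ::
  "(real \<Rightarrow> complex ^ 'n ^ 'n) \<Rightarrow> (real \<Rightarrow> complex ^ 'n) \<Rightarrow> real \<Rightarrow> complex ^ 'n" where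
  "schroedinger q y x = - dx (dx y) x + q x *v y x"

definition Dom_Lmax :: "(real \<Rightarrow> complex ^ 'n ^ 'n) \<Rightarrow> (real \<Rightarrow> complex ^ 'n) set" where
  "Dom_Lmax q = {y. y \<in> L2 \<and> y \<in> W21_loc \<and> schroedinger q y \<in> L2}"

definition Dom_Lmin :: "(real \<Rightarrow> complex ^ 'n ^ 'n) \<Rightarrow> (real \<Rightarrow> complex ^ 'n) set" where
  "Dom_Lmin q = {y \<in> Dom_Lmax q.
     compact (closure {x \<in> {0..}. y x \<noteq> 0}) \<and> closure {x \<in> {0..}. y x \<noteq> 0} \<subseteq> {0<..}}"

text \<open>The graph of the closure \<open>L\<^sub>0\<close> of \<open>L\<^sub>m\<^sub>i\<^sub>n\<close>: it consists of the pairs \<open>(y, L\<^sub>0 y)\<close>.\<close>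

definition L0_graph ::
  "(real \<Rightarrow> complex ^ 'n ^ 'n) \<Rightarrow> ((real \<Rightarrow> complex ^ 'n) \<times> (real \<Rightarrow> complex ^ 'n)) set" where
  "L0_graph q = {(y, z). y \<in> L2 \<and> z \<in> L2 \<and>
     (\<exists>p. (\<forall>k::nat. p k \<in> Dom_Lmin q) \<and>
          (\<lambda>k. L2_norm (\<lambda>x. p k x - y x)) \<longlonglongrightarrow> 0 \<and>
          (\<lambda>k. L2_norm (\<lambda>x. schroedinger q (p k) x - z x)) \<longlonglongrightarrow> 0)}"

definition L0_positive_definite :: "(real \<Rightarrow> complex ^ 'n ^ 'n) \<Rightarrow> bool" where
  "L0_positive_definite q \<longleftrightarrow>
     (\<exists>c>0. \<forall>(y, z) \<in> L0_graph q. L2_inner z y \<in> \<real> \<and> Re (L2_inner z y) \<ge> c * (L2_norm y)\<^sup>2)"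

section \<open>The boundary control and the kernel\<close>

definition smooth_on_Icc :: "real \<Rightarrow> (real \<Rightarrow> complex ^ 'n) \<Rightarrow> bool" where
  "smooth_on_Icc T f \<longleftrightarrow>
     (\<exists>D :: nat \<Rightarrow> real \<Rightarrow> complex ^ 'n. (\<forall>t\<in>{0..T}. D 0 t = f t) \<and>
        (\<forall>k. \<forall>t\<in>{0..T}. (D k has_vector_derivative D (Suc k) t) (at t within {0..T})))"

text \<open>
  In the equation below all integrands are absolutely integrable when \<open>q\<close> is locally summable and
  \<open>v\<close> is continuous, so \<^const>\<open>integral\<close> is the Lebesgue integral. Note that \<open>**\<close> is the matrix
  product.
\<close>

definition goursat_solution ::
  "(real \<Rightarrow> complex ^ 'n ^ 'n) \<Rightarrow> (real \<Rightarrow> real \<Rightarrow> complex ^ 'n ^ 'n) \<Rightarrow> bool" where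
  "goursat_solution q v \<longleftrightarrow>
     continuous_on {(\<xi>, \<eta>). 0 \<le> \<xi> \<and> \<xi> \<le> \<eta>} (\<lambda>(\<xi>, \<eta>). v \<xi> \<eta>) \<and>
     (\<forall>\<xi> \<eta>. 0 \<le> \<xi> \<and> \<xi> \<le> \<eta> \<longrightarrow>
        v \<xi> \<eta> = - ((1/2) *\<^sub>R integral {\<xi>/2..\<eta>/2} q)
          - (1/4) *\<^sub>R integral {0..\<xi>} (\<lambda>\<xi>1. integral {\<xi>..\<eta>} (\<lambda>\<eta>1. q ((\<eta>1 - \<xi>1) / 2) ** v \<xi>1 \<eta>1)))"

definition kernel_w ::
  "(real \<Rightarrow> real \<Rightarrow> complex ^ 'n ^ 'n) \<Rightarrow> real \<Rightarrow> real \<Rightarrow> complex ^ 'n ^ 'n" where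
  "kernel_w v x t = v (t - x) (t + x)"

definition extend0 :: "(real \<Rightarrow> complex ^ 'n) \<Rightarrow> real \<Rightarrow> complex ^ 'n" where
  "extend0 f s = (if s < 0 then 0 else f s)"

text \<open>For \<open>x > t\<close> the interval \<open>{x..t}\<close> is empty, so the integral is zero there.\<close>

definition wave ::
  "(real \<Rightarrow> real \<Rightarrow> complex ^ 'n ^ 'n) \<Rightarrow> (real \<Rightarrow> complex ^ 'n) \<Rightarrow> real \<Rightarrow> real \<Rightarrow> complex ^ 'n" where
  "wave w f x t = extend0 f (t - x) + integral {x..t} (\<lambda>s. w x s *v extend0 f (t - s))"

section \<open>The dynamical system with boundary control\<close>

text \<open>
  \<open>Dom L\<^sub>0\<^sup>*\<close> is \<^const>\<open>Dom_Lmax\<close>, since \<open>L\<^sub>0\<^sup>* = L\<^sub>m\<^sub>a\<^sub>x\<close>. The functions \<open>ud t\<close> and \<open>udd t\<close> are the first and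
  second \<open>L\<^sub>2\<close>-valued time derivatives of \<open>u\<close> at \<open>t\<close>; the first one is one-sided at \<open>t = 0\<close>.
\<close>

definition solves_system ::
  "(real \<Rightarrow> complex ^ 'n ^ 'n) \<Rightarrow> real \<Rightarrow> (real \<Rightarrow> complex ^ 'n) \<Rightarrow>
   (real \<Rightarrow> real \<Rightarrow> complex ^ 'n) \<Rightarrow> bool" where
  "solves_system q T f u \<longleftrightarrow>
     (\<forall>t\<in>{0..T}. (\<lambda>x. u x t) \<in> Dom_Lmax q) \<and>
     (\<exists>ud udd.
        (\<forall>t\<in>{0..<T}. has_L2_derivative (\<lambda>s x. u x s) (ud t) t {0..T}) \<and>
        (\<forall>t\<in>{0<..<T}. has_L2_derivative ud (udd t) t {0<..<T}) \<and>
        (\<forall>t\<in>{0<..<T}. AE x in lebesgue_on {0..}.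
            udd t x - dx (dx (\<lambda>x'. u x' t)) x + q x *v u x t = 0) \<and>
        (AE x in lebesgue_on {0..}. ud 0 x = 0)) \<and>
     (\<forall>x\<ge>0. u x 0 = 0) \<and>
     (\<forall>t\<in>{0..T}. u 0 t = f t)"

end

theory Submission
  imports Defs
begin

text \<open>
  With \<open>k x r = w(x, x + r) = v(r, r + 2 x)\<close>, put
  \<open>U[G](x,t) = G(t - x) + \<integral>\<^sub>0 k x r G(t - x - r) dr\<close> for a function \<open>G\<close> vanishing on the negative half-line, so
  that \<open>u = U[f]\<close> and \<open>\<partial>\<^sub>t U[G] = U[G']\<close>. As \<open>q\<close> is only summable, \<open>w\<close> cannot be differentiated in \<open>x\<close>.
  Instead, Fubini's theorem turns the Goursat equation into Duhamel's formula
  \<open>U[G'](x,t) = G'(t - x) - 1/2 \<integral> q(y) (U[G](y, t - \<bar>x - y\<bar>) - U[G](y, t - x - y)) dy\<close>,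
  in which \<open>x\<close> enters only through the time argument, where \<open>U[G]\<close> is smooth. Integrating this formula
  for \<open>G' = f''\<close> twice in \<open>x\<close> yields
  \<open>u(x,t) = u(0,t) + b x + \<integral>\<^sub>0\<^sup>x (x - y) (u\<^sub>t\<^sub>t + q u)(y,t) dy\<close>; the kink of \<open>\<bar>x - y\<bar>\<close> produces the
  potential term. Hence \<open>u\<close> and \<open>u\<^sub>x\<close> are locally absolutely continuous in \<open>x\<close> and the wave equation holds
  almost everywhere by Lebesgue's differentiation theorem.
\<close>

section \<open>Fubini's theorem for bilinear products\<close>

text \<open>Duhamel's formula loses one time derivative: the wave of \<open>G'\<close> is expressed
  through waves of \<open>G\<close>. This fixes the four levels used below: \<open>G 1\<close>
  continues f, \<open>G 0\<close> is an antiderivative of it, and \<open>G 2\<close>,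
  \<open>G 3\<close> are f' and f'' on [0,T]. The formula is used twice. For \<open>G 3\<close> it
  contains the wave of \<open>G 2\<close> at the times t - |x - y| and t - x - y, and two
  integrations in x turn these into waves of \<open>G 0\<close> at the same times. For
  \<open>G 1\<close> it contains exactly these waves of \<open>G 0\<close>, so they can be
  eliminated between the two, and continuity of the kernel suffices throughout. The control is
  continued beyond T so that all levels are differentiable from both sides on the whole line and no
  end point needs separate treatment. The order of integration is exchanged repeatedly with one
  factor merely summable and the other cut off by inequalities; hence the Fubini theorem for a
  summable and a bounded Borel factor.\<close>

lemma bounded_bilinear_matrix_vector_mult:
  "bounded_bilinear ((*v) :: complex ^ 'n ^ 'm \<Rightarrow> complex ^ 'n \<Rightarrow> complex ^ 'm)"
proof -
  have "bilinear ((*v) :: complex ^ 'n ^ 'm \<Rightarrow> complex ^ 'n \<Rightarrow> complex ^ 'm)"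
    unfolding bilinear_def
    by (auto intro!: linearI simp: matrix_vector_mult_def vec_eq_iff algebra_simps sum.distrib scaleR_sum_right)
  then show ?thesis
    by (simp add: bilinear_conv_bounded_bilinear)
qed

lemma bounded_bilinear_matrix_matrix_mult:
  "bounded_bilinear ((**) :: complex ^ 'n ^ 'm \<Rightarrow> complex ^ 'k ^ 'n \<Rightarrow> complex ^ 'k ^ 'm)"
proof -
  have "bilinear ((**) :: complex ^ 'n ^ 'm \<Rightarrow> complex ^ 'k ^ 'n \<Rightarrow> complex ^ 'k ^ 'm)"
    unfolding bilinear_def
    by (auto intro!: linearI simp: matrix_matrix_mult_def vec_eq_iff algebra_simps sum.distrib scaleR_sum_right)
  then show ?thesis
    by (simp add: bilinear_conv_bounded_bilinear)
qed

text \<open>Each real coordinate agrees almost everywhere with a Borel function, and finitely many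
  null sets are discarded. A Borel version of q is needed because functions of \<open>fst\<close>
  and \<open>snd\<close> are measured in the product of the Borel algebras.\<close>

lemma lebesgue_ex_borel_measurable:
  fixes g :: "'a::euclidean_space \<Rightarrow> 'b::euclidean_space"
  assumes "g \<in> borel_measurable lebesgue"
  obtains g' where "g' \<in> borel_measurable borel" "AE x in lebesgue. g x = g' x"
proof -
  have "\<forall>b\<in>Basis. \<exists>h. h \<in> borel_measurable lborel \<and> (AE x in lborel. g x \<bullet> b = h x)"
  proof
    fix b :: 'b assume "b \<in> Basis"
    have "(\<lambda>x. g x \<bullet> b) \<in> borel_measurable lebesgue" using assms by simp
    then show "\<exists>h. h \<in> borel_measurable lborel \<and> (AE x in lborel. g x \<bullet> b = h x)"
      using completion_ex_borel_measurable_real by blast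
  qed
  then obtain h where h: "\<And>b. b \<in> Basis \<Longrightarrow> h b \<in> borel_measurable lborel"
      "\<And>b. b \<in> Basis \<Longrightarrow> AE x in lborel. g x \<bullet> b = h b x"
    by metis
  define g' where "g' = (\<lambda>x. \<Sum>b\<in>Basis. h b x *\<^sub>R b)"
  have "g' \<in> borel_measurable borel"
    unfolding g'_def using h(1) by (intro borel_measurable_sum borel_measurable_scaleR) auto
  moreover have "AE x in lborel. \<forall>b\<in>Basis. g x \<bullet> b = h b x"
    using h(2) by (simp add: AE_finite_all)
  then have "AE x in lborel. g x = g' x"
    by eventually_elim (simp add: g'_def euclidean_eq_iff[where 'a='b])
  then have "AE x in lebesgue. g x = g' x"
    by (rule AE_completion)
  ultimately show ?thesis using that by blast
qed

text \<open>Bridge from integrals over a set to Bochner integrals over the whole space: Fubini's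
  theorem is applied to modified representatives, and its results are read off for the original
  functions.\<close>

lemma absolutely_integrable_on_AE_eq:
  fixes h g :: "'a::euclidean_space \<Rightarrow> 'b::euclidean_space"
  assumes "integrable lborel g" "AE x in lebesgue. indicator S x *\<^sub>R h x = g x"
  shows "h absolutely_integrable_on S" "integral S h = (LINT x|lborel. g x)"
proof -
  have g: "g \<in> borel_measurable lebesgue" "integrable lebesgue g"
    using assms(1) by (simp_all add: integrable_completion[of g lborel] measurable_completion[of g lborel])
  have m: "(\<lambda>x. indicator S x *\<^sub>R h x) \<in> borel_measurable lebesgue"
    by (rule borel_measurable_AE[OF g(1)]) (use assms(2) in eventually_elim, simp)
  have "integrable lebesgue (\<lambda>x. indicator S x *\<^sub>R h x)"
    using integrable_cong_AE[OF m g(1) assms(2)] g(2) by simp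
  then show a: "h absolutely_integrable_on S"
    by (simp add: set_integrable_def)
  have "integral S h = (LINT x|lebesgue. indicator S x *\<^sub>R h x)"
    using set_lebesgue_integral_eq_integral(2)[OF a] by (simp add: set_lebesgue_integral_def)
  also have "\<dots> = (LINT x|lebesgue. g x)"
    by (rule integral_cong_AE[OF m g(1) assms(2)])
  also have "\<dots> = (LINT x|lborel. g x)"
    using assms(1) by (simp add: integral_completion)
  finally show "integral S h = (LINT x|lborel. g x)" .
qed

text \<open>After truncation to the rectangle the product is dominated by a multiple of |q(y)| times
  the indicator of [c,d], which is integrable on the plane. Only measurability and a bound are asked
  of k, so kernels cut off by inequalities are admissible. As the bound holds at every point, the
  slice in y is integrable for each z, not merely for almost every z.\<close>

lemma Fubini_bilinear:
  fixes B :: "'a::euclidean_space \<Rightarrow> 'b::euclidean_space \<Rightarrow> 'c::euclidean_space"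
    and q :: "real \<Rightarrow> 'a" and k :: "real \<Rightarrow> real \<Rightarrow> 'b"
  assumes B: "bounded_bilinear B" and q: "q absolutely_integrable_on {a..b}"
    and k: "(\<lambda>p. k (fst p) (snd p)) \<in> borel_measurable borel"
    and bd: "\<And>y z. y \<in> {a..b} \<Longrightarrow> z \<in> {c..d} \<Longrightarrow> norm (k y z) \<le> C"
  shows "z \<in> {c..d} \<Longrightarrow> (\<lambda>y. B (q y) (k y z)) absolutely_integrable_on {a..b}"
    and "(\<lambda>z. integral {a..b} (\<lambda>y. B (q y) (k y z))) absolutely_integrable_on {c..d}"
    and "(\<lambda>y. B (q y) (integral {c..d} (k y))) absolutely_integrable_on {a..b}"
    and "integral {c..d} (\<lambda>z. integral {a..b} (\<lambda>y. B (q y) (k y z))) =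
         integral {a..b} (\<lambda>y. B (q y) (integral {c..d} (k y)))"
proof -
  interpret B: bounded_bilinear B by (fact B)
  have km[measurable]: "(\<lambda>p. k (fst p) (snd p)) \<in> borel_measurable (borel \<Otimes>\<^sub>M borel)"
    using k by (simp add: borel_prod)
  have ky[measurable]: "k y \<in> borel_measurable borel" for y
    using measurable_compose[OF measurable_Pair1'[of y borel borel] km] by simp
  have "(\<lambda>y. indicator {a..b} y *\<^sub>R q y) \<in> borel_measurable lebesgue"
    using q by (auto simp: set_integrable_def)
  then obtain q' where q'[measurable]: "q' \<in> borel_measurable borel"
    and eq: "AE y in lebesgue. indicator {a..b} y *\<^sub>R q y = q' y"
    by (rule lebesgue_ex_borel_measurable)
  have q'i: "integrable lborel q'"
  proof -
    have i: "integrable lebesgue (\<lambda>y. indicator {a..b} y *\<^sub>R q y)"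
      using q by (simp add: set_integrable_def)
    have "q' \<in> borel_measurable lebesgue"
      using q' by (intro measurable_completion) simp
    with i have "integrable lebesgue q'"
      using integrable_cong_AE[OF borel_measurable_integrable[OF i] _ eq] by blast
    then show ?thesis using q' integrable_completion[of q' lborel] by simp
  qed
  define q2 where "q2 y = indicator {a..b} y *\<^sub>R q' y" for y
  have [measurable]: "q2 \<in> borel_measurable borel"
    unfolding q2_def by measurable
  have q2i: "integrable lborel q2"
    unfolding q2_def using q'i by (intro integrable_mult_indicator) auto
  have eq2: "AE y in lebesgue. indicator {a..b} y *\<^sub>R q y = q2 y"
    using eq by eventually_elim (auto simp: q2_def indicator_def)
  define k2 where "k2 y z = indicator {a..b} y *\<^sub>R indicator {c..d} z *\<^sub>R k y z" for y z
  have [measurable]: "(\<lambda>p. k2 (fst p) (snd p)) \<in> borel_measurable (borel \<Otimes>\<^sub>M borel)"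
    unfolding k2_def by measurable
  define H where "H p = B (q2 (fst p)) (k2 (fst p) (snd p))" for p
  have Hm: "H \<in> borel_measurable (lborel \<Otimes>\<^sub>M lborel)"
  proof -
    have "(\<lambda>p. (q2 (fst p), k2 (fst p) (snd p))) \<in> (borel \<Otimes>\<^sub>M borel) \<rightarrow>\<^sub>M (borel \<Otimes>\<^sub>M borel)"
      by measurable
    moreover have "(\<lambda>p. B (fst p) (snd p)) \<in> borel_measurable borel"
      by (intro borel_measurable_continuous_onI B.continuous_on continuous_intros)
    ultimately have "(\<lambda>p. B (q2 (fst p)) (k2 (fst p) (snd p))) \<in> borel_measurable (borel \<Otimes>\<^sub>M borel)"
      using measurable_compose[of "\<lambda>p. (q2 (fst p), k2 (fst p) (snd p))" _ "borel \<Otimes>\<^sub>M borel" "\<lambda>p. B (fst p) (snd p)" borel]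
      by (simp add: borel_prod)
    then show ?thesis unfolding H_def[abs_def] by simp
  qed
  obtain K where K: "K > 0" "\<And>x y. norm (B x y) \<le> norm x * norm y * K"
    using B.pos_bounded by blast
  \<comment> \<open>On an empty rectangle the hypothesis does not restrict \<open>C\<close>, which
    may then be negative.\<close>
  define D where "D = max C 0"
  have k2b: "norm (k2 y z) \<le> indicator {c..d} z * D" for y z
    using bd[of y z] by (auto simp: k2_def D_def indicator_def)
  have ci: "integrable lborel (indicat_real {c..d})"
    by (rule integrable_real_indicator) (auto simp: emeasure_lborel_Icc_eq)
  have dom: "integrable (lborel \<Otimes>\<^sub>M lborel) (\<lambda>p. norm (q2 (fst p)) * indicator {c..d} (snd p))"
  proof (rule lborel_pair.Fubini_integrable)
    show "(\<lambda>p. norm (q2 (fst p)) * indicator {c..d} (snd p)) \<in> borel_measurable (lborel \<Otimes>\<^sub>M lborel)"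
      by measurable
    show "integrable lborel (\<lambda>x. LINT y|lborel. norm (norm (q2 (fst (x, y))) * indicat_real {c..d} (snd (x, y))))"
      using q2i by (simp add: abs_mult)
    show "AE x in lborel. integrable lborel (\<lambda>y. norm (q2 (fst (x, y))) * indicat_real {c..d} (snd (x, y)))"
      by (intro AE_I2) (simp add: ci)
  qed
  have Hi: "integrable (lborel \<Otimes>\<^sub>M lborel) H"
  proof (rule Bochner_Integration.integrable_bound[OF integrable_mult_left[OF dom, of "D * K"] Hm])
    have "norm (H p) \<le> norm (q2 (fst p)) * indicator {c..d} (snd p) * (D * K)" for p
    proof -
      have "norm (H p) \<le> norm (q2 (fst p)) * norm (k2 (fst p) (snd p)) * K"
        unfolding H_def by (rule K)
      also have "\<dots> \<le> norm (q2 (fst p)) * (indicator {c..d} (snd p) * D) * K"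
        using K k2b by (intro mult_right_mono mult_left_mono) auto
      finally show ?thesis by (simp add: algebra_simps)
    qed
    then show "AE p in lborel \<Otimes>\<^sub>M lborel. norm (H p) \<le> norm (norm (q2 (fst p)) * indicat_real {c..d} (snd p) * (D * K))"
      by (intro AE_I2) (use order_trans abs_ge_self in fastforce)
  qed
  have Hz: "integrable lborel (\<lambda>y. H (y, z))" for z
  proof (rule Bochner_Integration.integrable_bound[OF integrable_mult_left[OF integrable_norm[OF q2i], of "D * K"]])
    show "(\<lambda>y. H (y, z)) \<in> borel_measurable lborel"
      using Hm by measurable
    have "norm (H (y, z)) \<le> norm (norm (q2 y) * (D * K))" for y
    proof -
      have "norm (H (y, z)) \<le> norm (q2 y) * norm (k2 y z) * K"
        unfolding H_def using K by simp
      also have "\<dots> \<le> norm (q2 y) * D * K"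
        using K k2b[of y z] by (intro mult_right_mono mult_left_mono) (auto simp: D_def of_bool_def indicator_def split: if_splits)
      also have "\<dots> \<le> norm (norm (q2 y) * (D * K))"
        using K(1) by (simp add: abs_mult mult.assoc D_def)
      finally show ?thesis .
    qed
    then show "AE y in lborel. norm (H (y, z)) \<le> norm (norm (q2 y) * (D * K))"
      by (intro AE_I2)
  qed
  have aeH: "AE y in lebesgue. indicator {a..b} y *\<^sub>R B (q y) (k y z) = H (y, z)" if "z \<in> {c..d}" for z
    using eq2 by eventually_elim
      (use that in \<open>auto simp: H_def k2_def q2_def indicator_def B.zero_left B.zero_right split: if_splits\<close>)
  have k2i: "integrable lborel (k2 y)" for y
  proof (rule Bochner_Integration.integrable_bound)
    show "integrable lborel (\<lambda>z. indicator {c..d} z * D)" by (simp add: ci)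
    show "k2 y \<in> borel_measurable lborel" unfolding k2_def by measurable
    show "AE z in lborel. norm (k2 y z) \<le> norm (indicat_real {c..d} z * D)"
      using k2b by (intro AE_I2) (metis abs_ge_self order_trans real_norm_def)
  qed
  have kint: "integral {c..d} (k y) = (LINT z|lborel. k2 y z)" if "y \<in> {a..b}" for y
    by (rule absolutely_integrable_on_AE_eq(2)[OF k2i]) (use that in \<open>simp add: k2_def\<close>)
  have Hy: "(LINT z|lborel. H (y, z)) = B (q2 y) (LINT z|lborel. k2 y z)" for y
    unfolding H_def fst_conv snd_conv
    by (rule integral_bounded_linear[OF B.bounded_linear_right k2i])
  have aeH2: "AE y in lebesgue. indicator {a..b} y *\<^sub>R B (q y) (integral {c..d} (k y)) = (LINT z|lborel. H (y, z))"
    using eq2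
  proof eventually_elim
    case (elim y)
    show ?case
      by (cases "y \<in> {a..b}") (use elim in \<open>auto simp: Hy kint q2_def B.zero_left\<close>)
  qed
  show 1: "(\<lambda>y. B (q y) (k y z)) absolutely_integrable_on {a..b}" if "z \<in> {c..d}" for z
    by (rule absolutely_integrable_on_AE_eq(1)[OF Hz aeH[OF that]])
  have 2: "integral {a..b} (\<lambda>y. B (q y) (k y z)) = (LINT y|lborel. H (y, z))" if "z \<in> {c..d}" for z
    by (rule absolutely_integrable_on_AE_eq(2)[OF Hz aeH[OF that]])
  have ae3: "AE z in lebesgue. indicator {c..d} z *\<^sub>R integral {a..b} (\<lambda>y. B (q y) (k y z)) = (LINT y|lborel. H (y, z))"
  proof (intro AE_I2)
    fix z :: real
    show "indicator {c..d} z *\<^sub>R integral {a..b} (\<lambda>y. B (q y) (k y z)) = (LINT y|lborel. H (y, z))"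
      by (cases "z \<in> {c..d}") (auto simp: 2 H_def k2_def B.zero_right)
  qed
  have i3: "integrable lborel (\<lambda>z. LINT y|lborel. H (y, z))"
    using lborel_pair.integrable_snd[of "\<lambda>y z. H (y, z)"] Hi by simp
  have i4: "integrable lborel (\<lambda>y. LINT z|lborel. H (y, z))"
    using lborel_pair.integrable_fst'[OF Hi] .
  show "(\<lambda>z. integral {a..b} (\<lambda>y. B (q y) (k y z))) absolutely_integrable_on {c..d}"
    by (rule absolutely_integrable_on_AE_eq(1)[OF i3 ae3])
  show "(\<lambda>y. B (q y) (integral {c..d} (k y))) absolutely_integrable_on {a..b}"
    by (rule absolutely_integrable_on_AE_eq(1)[OF i4 aeH2])
  have "integral {c..d} (\<lambda>z. integral {a..b} (\<lambda>y. B (q y) (k y z))) = (LINT z|lborel. LINT y|lborel. H (y, z))"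
    by (rule absolutely_integrable_on_AE_eq(2)[OF i3 ae3])
  also have "\<dots> = (LINT y|lborel. LINT z|lborel. H (y, z))"
    using lborel_pair.Fubini_integral[of "\<lambda>y z. H (y, z)"] Hi by simp
  also have "\<dots> = integral {a..b} (\<lambda>y. B (q y) (integral {c..d} (k y)))"
    by (rule absolutely_integrable_on_AE_eq(2)[OF i4 aeH2, symmetric])
  finally show "integral {c..d} (\<lambda>z. integral {a..b} (\<lambda>y. B (q y) (k y z))) =
         integral {a..b} (\<lambda>y. B (q y) (integral {c..d} (k y)))" .
qed

section \<open>Indefinite integrals of summable functions\<close>

text \<open>Truncation at height n: the excess of |g| over n has integral below e/2 for large n by
  dominated convergence, and the bounded part contributes at most n times the total length of the
  intervals.\<close>

lemma absolutely_continuous_on_indefinite_integral: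
  fixes g :: "real \<Rightarrow> 'a::euclidean_space"
  assumes g: "g absolutely_integrable_on {A..R}"
  shows "absolutely_continuous_on A R (\<lambda>x. c + integral {A..x} g)"
  unfolding absolutely_continuous_on_def
proof (intro allI impI)
  fix e :: real assume e: "e > 0"
  define \<phi> where "\<phi> x = norm (g x)" for x
  define h where "h n x = \<phi> x - min (\<phi> x) (real n)" for n x
  have ai: "(\<lambda>x. norm (g x)) absolutely_integrable_on {A..R}"
    using g by (rule absolutely_integrable_norm[unfolded o_def])
  have phi_ai: "\<phi> absolutely_integrable_on {A..R}"
    using ai by (simp add: \<phi>_def[abs_def])
  have phi_i: "\<phi> integrable_on {A..R}"
    using phi_ai set_lebesgue_integral_eq_integral(1) by blast
  have min_ai: "(\<lambda>x. min (\<phi> x) (real n)) absolutely_integrable_on {A..R}" for n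
    using absolutely_integrable_min_1[OF phi_ai, of "\<lambda>_. real n"] by simp
  have hi: "h n integrable_on {A..R}" for n
    unfolding h_def[abs_def]
    using phi_ai min_ai set_integral_diff(1)[of lebesgue "{A..R}" \<phi>] set_lebesgue_integral_eq_integral(1) by blast
  have h0: "0 \<le> h n x" "h n x \<le> \<phi> x" for n x
    by (auto simp: h_def \<phi>_def)
  have lim: "(\<lambda>n. integral {A..R} (h n)) \<longlonglongrightarrow> integral {A..R} (\<lambda>x. 0)"
  proof (rule dominated_convergence(2)[OF hi phi_i])
    show "norm (h n x) \<le> \<phi> x" for n x using h0[of n x] by simp
    fix x
    obtain n0 where "\<phi> x \<le> real n0" using real_arch_simple by blast
    then have "eventually (\<lambda>n. h n x = 0) sequentially"
      by (intro eventually_sequentiallyI[of n0]) (auto simp: h_def min_def)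
    then show "(\<lambda>n. h n x) \<longlonglongrightarrow> 0"
      by (rule tendsto_eventually)
  qed
  then have "eventually (\<lambda>n. integral {A..R} (h n) < e / 2) sequentially"
    using e by (intro order_tendstoD) auto
  then obtain n where n: "integral {A..R} (h n) < e / 2"
    by (auto simp: eventually_sequentially)
  \<comment> \<open>The choice of n + 1 instead of n keeps the denominator positive for n = 0; the
    bounded part then contributes at most e/2.\<close>
  define \<delta> where "\<delta> = e / (2 * (real n + 1))"
  have \<delta>: "\<delta> > 0" using e by (simp add: \<delta>_def)
  show "\<exists>\<delta>>0. \<forall>(N::nat) a b.
        (\<forall>k<N. A \<le> a k \<and> a k \<le> b k \<and> b k \<le> R) \<and>
        pairwise (\<lambda>j k. {a j<..<b j} \<inter> {a k<..<b k} = {}) {..<N} \<and>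
        (\<Sum>k<N. b k - a k) < \<delta> \<longrightarrow>
        (\<Sum>k<N. norm ((c + integral {A..b k} g) - (c + integral {A..a k} g))) < e"
  proof (intro exI[of _ \<delta>] conjI allI impI \<delta>)
    fix N :: nat and a b :: "nat \<Rightarrow> real"
    assume *: "(\<forall>k<N. A \<le> a k \<and> a k \<le> b k \<and> b k \<le> R) \<and>
        pairwise (\<lambda>j k. {a j<..<b j} \<inter> {a k<..<b k} = {}) {..<N} \<and>
        (\<Sum>k<N. b k - a k) < \<delta>"
    have gi: "g integrable_on {A..R}" using g set_lebesgue_integral_eq_integral(1) by blast
    have one: "norm ((c + integral {A..b k} g) - (c + integral {A..a k} g))
        \<le> integral {A..R} (\<lambda>x. indicator {a k<..<b k} x * h n x) + real n * (b k - a k)" if k: "k < N" for k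
    proof -
      have ab: "A \<le> a k" "a k \<le> b k" "b k \<le> R" using * k by auto
      have sub: "{a k..b k} \<subseteq> {A..R}" using ab by auto
      have gab: "g absolutely_integrable_on {a k..b k}"
        by (rule set_integrable_subset[OF g]) (use sub in auto)
      have "integral {A..a k} g + integral {a k..b k} g = integral {A..b k} g"
        using ab by (intro Henstock_Kurzweil_Integration.integral_combine integrable_on_subinterval[OF gi]) auto
      then have "norm ((c + integral {A..b k} g) - (c + integral {A..a k} g)) = norm (integral {a k..b k} g)"
        by (metis add_diff_cancel_left add_diff_cancel_left')
      also have "\<dots> \<le> integral {a k..b k} \<phi>"
        unfolding \<phi>_def using gab
        by (intro integral_norm_bound_integral set_lebesgue_integral_eq_integral(1) absolutely_integrable_norm[unfolded o_def]) auto
      also have "\<dots> \<le> integral {a k..b k} (\<lambda>x. h n x + real n)"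
        using sub by (intro integral_le integrable_on_subinterval[OF phi_i] integrable_add
            integrable_on_subinterval[OF hi]) (auto simp: h_def)
      also have "\<dots> = integral {a k..b k} (h n) + real n * (b k - a k)"
        using ab sub by (subst integral_add) (auto intro: integrable_on_subinterval[OF hi])
      \<comment> \<open>Only the open intervals are assumed disjoint; without their end points the
        indicators add up to the indicator of the union.\<close>
      also have "integral {a k..b k} (h n) = integral {a k<..<b k} (h n)"
        using integral_open_interval_real[of "a k" "b k" "h n"] by simp
      also have "\<dots> = integral {A..R} (\<lambda>x. if x \<in> {a k<..<b k} then h n x else 0)"
        using ab by (subst integral_restrict_Int) (auto intro!: arg_cong[where f="\<lambda>S. integral S (h n)"])
      also have "(\<lambda>x. if x \<in> {a k<..<b k} then h n x else 0) = (\<lambda>x. indicator {a k<..<b k} x * h n x)"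
        by (auto simp: indicator_def)
      finally show ?thesis by simp
    qed
    have ii: "(\<lambda>x. indicator {a k<..<b k} x * h n x) integrable_on {A..R}" if "k < N" for k
    proof -
      have "h n integrable_on {a k<..<b k}"
        by (rule integrable_on_open_interval_real[THEN iffD2], rule integrable_on_subinterval[OF hi]) (use * that in auto)
      then have "(\<lambda>x. if x \<in> {a k<..<b k} then h n x else 0) integrable_on {A..R}"
        using * that by (subst integrable_restrict_Int) (auto elim!: back_subst[where P="\<lambda>S. h n integrable_on S"])
      then show ?thesis
        by (rule integrable_eq) (auto simp: indicator_def)
    qed
    have disj: "disjoint_family_on (\<lambda>k. {a k<..<b k}) {..<N}"
      using * unfolding disjoint_family_on_def pairwise_def by blast
    have "(\<Sum>k<N. norm ((c + integral {A..b k} g) - (c + integral {A..a k} g)))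
       \<le> (\<Sum>k<N. integral {A..R} (\<lambda>x. indicator {a k<..<b k} x * h n x) + real n * (b k - a k))"
      by (rule sum_mono) (use one in auto)
    also have "\<dots> = integral {A..R} (\<lambda>x. \<Sum>k<N. indicator {a k<..<b k} x * h n x) + real n * (\<Sum>k<N. b k - a k)"
      by (subst Henstock_Kurzweil_Integration.integral_sum) (auto simp: ii sum.distrib sum_distrib_left)
    also have "(\<lambda>x. \<Sum>k<N. indicator {a k<..<b k} x * h n x) = (\<lambda>x. indicator (\<Union>k<N. {a k<..<b k}) x * h n x)"
      by (simp add: indicator_UN_disjoint[OF _ disj] sum_distrib_right)
    also have "integral {A..R} (\<lambda>x. indicator (\<Union>k<N. {a k<..<b k}) x * h n x) \<le> integral {A..R} (h n)"
    proof (rule integral_le[OF _ hi])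
      have "(\<lambda>x. \<Sum>k<N. indicator {a k<..<b k} x * h n x) integrable_on {A..R}"
        by (intro integrable_sum) (auto simp: ii)
      then show "(\<lambda>x. indicator (\<Union>k<N. {a k<..<b k}) x * h n x) integrable_on {A..R}"
        by (simp add: indicator_UN_disjoint[OF _ disj] sum_distrib_right)
    qed (auto simp: indicator_def h0)
    also have "real n * (\<Sum>k<N. b k - a k) \<le> (real n + 1) * \<delta>"
      using * \<delta> by (intro mult_mono) (auto intro: sum_nonneg)
    also have "\<dots> = e / 2" by (simp add: \<delta>_def field_simps)
    finally show "(\<Sum>k<N. norm ((c + integral {A..b k} g) - (c + integral {A..a k} g))) < e"
      using n by simp
  qed
qed

text \<open>Averages over [x, x + h] with h > 0 give the right derivative. The left derivative is
  the same statement for the reflected function, so the exceptional set is the union of a null set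
  and a reflected null set.\<close>

lemma Lebesgue_differentiation_indefinite_integral:
  fixes g :: "real \<Rightarrow> 'a::euclidean_space"
  assumes g: "\<And>R. g integrable_on {A..R}"
  obtains N where "negligible N"
    "\<And>x. x > A \<Longrightarrow> x \<notin> N \<Longrightarrow> ((\<lambda>x. integral {A..x} g) has_vector_derivative g x) (at x)"
proof -
  define g0 where "g0 x = (if x \<in> {A..} then g x else 0)" for x
  have g0i: "g0 integrable_on cbox a b" for a b
  proof -
    have "g integrable_on {max a A..b}"
      by (rule integrable_on_subinterval[OF g[of b]]) auto
    moreover have "{max a A..b} = {A..} \<inter> {a..b}" by auto
    ultimately show ?thesis
      unfolding g0_def[abs_def] using integrable_restrict_Int[of "{A..}" g "cbox a b"] by simp
  qed
  define g1 where "g1 x = g0 (- x)" for x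
  have g1i: "g1 integrable_on cbox a b" for a b
    using Henstock_Kurzweil_Integration.integrable_reflect_real[of g0 "-a" "-b"] g0i[of "-b" "-a"] by (simp add: g1_def[abs_def])
  obtain N1 where N1: "negligible N1"
    "\<And>x e. \<lbrakk>x \<notin> N1; 0 < e\<rbrakk> \<Longrightarrow> \<exists>d>0. \<forall>h. 0 < h \<and> h < d \<longrightarrow> norm (integral {x..x + h} g0 /\<^sub>R h - g0 x) < e"
    by (rule integrable_ccontinuous_explicit[OF g0i]) (auto simp: cbox_interval)
  obtain N2 where N2: "negligible N2"
    "\<And>x e. \<lbrakk>x \<notin> N2; 0 < e\<rbrakk> \<Longrightarrow> \<exists>d>0. \<forall>h. 0 < h \<and> h < d \<longrightarrow> norm (integral {x..x + h} g1 /\<^sub>R h - g1 x) < e"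
    by (rule integrable_ccontinuous_explicit[OF g1i]) (auto simp: cbox_interval)
  have "negligible (uminus ` N2)"
    by (rule negligible_differentiable_image_negligible[OF _ N2(1)])
      (auto intro!: derivative_intros simp: differentiable_on_def)
  then have neg: "negligible (N1 \<union> uminus ` N2)"
    using N1 by simp
  show ?thesis
  proof (rule that[OF neg])
    fix x assume x: "x > A" "x \<notin> N1 \<union> uminus ` N2"
    then have x1: "x \<notin> N1" and x2: "- x \<notin> N2" by force+
    define F where "F y = integral {A..y} g" for y
    have diff: "F b - F a = integral {a..b} g0" if "A \<le> a" "a \<le> b" for a b
    proof -
      have "integral {A..a} g + integral {a..b} g = integral {A..b} g"
        using that g by (intro Henstock_Kurzweil_Integration.integral_combine) auto
      moreover have "integral {a..b} g = integral {a..b} g0"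
        by (rule integral_cong) (use that in \<open>auto simp: g0_def\<close>)
      ultimately show ?thesis by (simp add: F_def algebra_simps)
    qed
    have "(F has_derivative (\<lambda>h. h *\<^sub>R g x)) (at x)"
      unfolding has_derivative_at_alt
    proof (intro conjI allI impI)
      show "bounded_linear (\<lambda>h. h *\<^sub>R g x)" by (rule bounded_linear_scaleR_left)
      fix e :: real assume e: "e > 0"
      obtain d1 where d1: "d1 > 0" "\<And>h. 0 < h \<and> h < d1 \<Longrightarrow> norm (integral {x..x + h} g0 /\<^sub>R h - g0 x) < e"
        using N1(2)[OF x1 e] by blast
      obtain d2 where d2: "d2 > 0" "\<And>h. 0 < h \<and> h < d2 \<Longrightarrow> norm (integral {-x..-x + h} g1 /\<^sub>R h - g1 (-x)) < e"
        using N2(2)[OF x2 e] by blast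
      have key: "norm (I - h *\<^sub>R w) \<le> e * h" if "0 < h" "norm (I /\<^sub>R h - w) < e" for I w :: 'a and h
      proof -
        have "I - h *\<^sub>R w = h *\<^sub>R (I /\<^sub>R h - w)" using that by (simp add: algebra_simps)
        then have "norm (I - h *\<^sub>R w) = h * norm (I /\<^sub>R h - w)" using that by simp
        also have "\<dots> \<le> h * e" using that by (intro mult_left_mono) auto
        finally show ?thesis by (simp add: mult.commute)
      qed
      show "\<exists>d>0. \<forall>y. norm (y - x) < d \<longrightarrow> norm (F y - F x - (y - x) *\<^sub>R g x) \<le> e * norm (y - x)"
      proof (intro exI[of _ "min (min d1 d2) (x - A)"] conjI allI impI)
        show "0 < min (min d1 d2) (x - A)" using d1 d2 x by auto
        fix y assume y: "norm (y - x) < min (min d1 d2) (x - A)"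
        then have yA: "y > A" by auto
        have gx: "g x = g0 x" using x by (simp add: g0_def)
        consider "y = x" | "y > x" | "y < x" by linarith
        then show "norm (F y - F x - (y - x) *\<^sub>R g x) \<le> e * norm (y - x)"
        proof cases
          case 1 then show ?thesis by simp
        next
          case 2
          then have "norm (integral {x..x + (y - x)} g0 - (y - x) *\<^sub>R g0 x) \<le> e * (y - x)"
            using y by (intro key d1) auto
          then show ?thesis using 2 x diff[of x y] gx by simp
        next
          case 3
          then have "norm (integral {-x..-x + (x - y)} g1 - (x - y) *\<^sub>R g1 (-x)) \<le> e * (x - y)"
            using y by (intro key d2) auto
          moreover have "integral {-x..-x + (x - y)} g1 = integral {y..x} g0"
            unfolding g1_def[abs_def] using Henstock_Kurzweil_Integration.integral_reflect_real[of x y g0] by simp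
          ultimately have "norm (F x - F y - (x - y) *\<^sub>R g x) \<le> e * (x - y)"
            using 3 yA diff[of y x] gx by (simp add: g1_def)
          moreover have "F y - F x - (y - x) *\<^sub>R g x = - (F x - F y - (x - y) *\<^sub>R g x)"
            by (simp add: algebra_simps)
          ultimately show ?thesis using 3 by (metis abs_minus_commute abs_of_pos diff_gt_0_iff_gt norm_minus_cancel real_norm_def)
        qed
      qed
    qed
    then show "((\<lambda>x. integral {A..x} g) has_vector_derivative g x) (at x)"
      by (simp add: has_vector_derivative_def F_def[abs_def])
  qed
qed

lemma absolutely_continuous_on_cong:
  assumes "\<And>x. x \<in> {A..R} \<Longrightarrow> y x = z x"
  shows "absolutely_continuous_on A R y \<longleftrightarrow> absolutely_continuous_on A R z"
proof -
  have "absolutely_continuous_on A R z" if "absolutely_continuous_on A R y" "\<And>x. x \<in> {A..R} \<Longrightarrow> y x = z x"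
    for y z :: "real \<Rightarrow> 'a"
    unfolding absolutely_continuous_on_def
  proof (intro allI impI)
    fix e :: real assume "e > 0"
    with that(1)[unfolded absolutely_continuous_on_def, THEN spec, of e]
    obtain d where d: "d > 0" and *: "\<forall>(N::nat) a b. (\<forall>k<N. A \<le> a k \<and> a k \<le> b k \<and> b k \<le> R) \<and>
        pairwise (\<lambda>j k. {a j<..<b j} \<inter> {a k<..<b k} = {}) {..<N} \<and>
        (\<Sum>k<N. b k - a k) < d \<longrightarrow> (\<Sum>k<N. norm (y (b k) - y (a k))) < e"
      by (elim impE exE conjE)
    show "\<exists>\<delta>>0. \<forall>(N::nat) a b. (\<forall>k<N. A \<le> a k \<and> a k \<le> b k \<and> b k \<le> R) \<and>
        pairwise (\<lambda>j k. {a j<..<b j} \<inter> {a k<..<b k} = {}) {..<N} \<and>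
        (\<Sum>k<N. b k - a k) < \<delta> \<longrightarrow> (\<Sum>k<N. norm (z (b k) - z (a k))) < e"
    proof (intro exI[of _ d] conjI d allI impI)
      fix N :: nat and a b :: "nat \<Rightarrow> real"
      assume ab: "(\<forall>k<N. A \<le> a k \<and> a k \<le> b k \<and> b k \<le> R) \<and>
        pairwise (\<lambda>j k. {a j<..<b j} \<inter> {a k<..<b k} = {}) {..<N} \<and>
        (\<Sum>k<N. b k - a k) < d"
      have "(\<Sum>k<N. norm (z (b k) - z (a k))) = (\<Sum>k<N. norm (y (b k) - y (a k)))"
      proof (rule sum.cong[OF refl])
        fix k assume "k \<in> {..<N}"
        then have "A \<le> a k" "a k \<le> b k" "b k \<le> R" using ab by auto
        then show "norm (z (b k) - z (a k)) = norm (y (b k) - y (a k))"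
          using that(2)[of "a k"] that(2)[of "b k"] by simp
      qed
      then show "(\<Sum>k<N. norm (z (b k) - z (a k))) < e" using *[rule_format, OF ab] by simp
    qed
  qed
  then show ?thesis using assms by metis
qed

section \<open>From an integral equation to membership in \<open>W21_loc\<close>\<close>

lemma dx_eq:
  assumes "(y has_vector_derivative D) (at x within {0..})" "x \<ge> 0"
  shows "dx y x = D"
  unfolding dx_def
proof (rule vector_derivative_within[OF _ assms(1)])
  have "x islimpt {x..x+1}" by (simp add: islimpt_Icc)
  then have "x islimpt {0..}" by (rule islimpt_subset) (use assms in auto)
  then show "at x within {0..} \<noteq> bot" by (simp add: trivial_limit_within)
qed

text \<open>Write x - y as the integral of 1 over [y,x] and exchange the order of integration on the
  triangle y \<le> z \<le> x.\<close>

lemma integral_diff_kernel: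
  fixes g :: "real \<Rightarrow> 'a::euclidean_space"
  assumes g: "g absolutely_integrable_on {0..x}"
  shows "integral {0..x} (\<lambda>y. (x - y) *\<^sub>R g y) = integral {0..x} (\<lambda>z. integral {0..z} g)"
proof -
  define k :: "real \<Rightarrow> real \<Rightarrow> real" where "k y z = (if y \<le> z then 1 else 0)" for y z
  have bb: "bounded_bilinear (\<lambda>(g::'a) r. r *\<^sub>R g)"
    using bounded_bilinear.flip[OF bounded_bilinear_scaleR] .
  have km: "(\<lambda>p. k (fst p) (snd p)) \<in> borel_measurable borel"
    unfolding k_def borel_prod[symmetric] by measurable
  have inner: "integral {0..x} (k y) = x - y" if "y \<in> {0..x}" for y
  proof -
    have "integral {0..x} (k y) = integral {0..x} (\<lambda>z. if z \<in> {y..x} then 1 else 0)"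
      by (rule integral_cong) (auto simp: k_def)
    also have "\<dots> = integral {y..x} (\<lambda>z. 1)"
      using that by (subst integral_restrict_Int) (auto simp: Int_absorb2)
    also have "\<dots> = x - y" using that by simp
    finally show ?thesis .
  qed
  have outer: "integral {0..x} (\<lambda>y. k y z *\<^sub>R g y) = integral {0..z} g" if "z \<in> {0..x}" for z
  proof -
    have "integral {0..x} (\<lambda>y. k y z *\<^sub>R g y) = integral {0..x} (\<lambda>y. if y \<in> {0..z} then g y else 0)"
      by (rule integral_cong) (auto simp: k_def)
    also have "\<dots> = integral {0..z} g"
      using that by (subst integral_restrict_Int) (auto simp: Int_absorb2)
    finally show ?thesis .
  qed
  have "integral {0..x} (\<lambda>y. (x - y) *\<^sub>R g y) = integral {0..x} (\<lambda>y. integral {0..x} (k y) *\<^sub>R g y)"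
    by (rule integral_cong) (simp add: inner)
  also have "\<dots> = integral {0..x} (\<lambda>z. integral {0..x} (\<lambda>y. k y z *\<^sub>R g y))"
    by (intro Fubini_bilinear(4)[OF bb g km, of 0 x 1, symmetric]) (simp add: k_def)
  also have "\<dots> = integral {0..x} (\<lambda>z. integral {0..z} g)"
    by (rule integral_cong) (simp add: outer)
  finally show ?thesis .
qed

text \<open>Rewriting the weighted integral as a twofold one shows that u - a is the integral of
  \<open>p\<close>, where \<open>p\<close> is b plus the integral of g. As \<open>p\<close> is
  continuous, u is differentiable everywhere with derivative \<open>p\<close>; and \<open>p\<close>,
  an indefinite integral, is absolutely continuous with derivative g off a null set.\<close>

lemma W21_loc_of_integral_equation:
  fixes u g :: "real \<Rightarrow> complex ^ 'n"
  assumes g: "L1_loc g"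
    and u: "\<And>x. x \<ge> 0 \<Longrightarrow> u x = a + x *\<^sub>R b + integral {0..x} (\<lambda>y. (x - y) *\<^sub>R g y)"
  shows "u \<in> W21_loc" "AE x in lebesgue_on {0..}. dx (dx u) x = g x"
proof -
  have gai: "g absolutely_integrable_on {0..R}" for R
  proof (cases "R > 0")
    case True then show ?thesis using g by (simp add: L1_loc_def)
  next
    case False
    then have "{0..R} \<subseteq> {0}" by auto
    then have "negligible {0..R}" using negligible_subset negligible_sing by blast
    then show ?thesis by (rule absolutely_integrable_negligible)
  qed
  have gi: "g integrable_on {0..R}" for R
    using gai set_lebesgue_integral_eq_integral(1) by blast
  define p where "p x = b + integral {0..x} g" for x
  have pc: "continuous_on {0..R} p" for R
    unfolding p_def by (intro continuous_intros indefinite_integral_continuous_1 gi)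
  have up: "u x = a + integral {0..x} p" if "x \<ge> 0" for x
  proof -
    have "integral {0..x} p = x *\<^sub>R b + integral {0..x} (\<lambda>z. integral {0..z} g)"
      unfolding p_def using that
      by (subst integral_add) (auto intro!: integrable_continuous_real indefinite_integral_continuous_1 gi)
    then show ?thesis using u[OF that] integral_diff_kernel[OF gai[of x]] by (simp add: add.assoc)
  qed
  have du: "(u has_vector_derivative p x) (at x within {0..})" if "x \<ge> 0" for x
  proof -
    have "((\<lambda>y. integral {0..y} p) has_vector_derivative p x) (at x within {0..x+1})"
      by (rule integral_has_vector_derivative[OF pc]) (use that in auto)
    then have "((\<lambda>y. a + integral {0..y} p) has_vector_derivative p x) (at x within {0..x+1})"
      by (auto intro!: derivative_eq_intros)
    then have "(u has_vector_derivative p x) (at x within {0..x+1})"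
      by (rule has_vector_derivative_transform[rotated 2]) (use that up in auto)
    moreover have "at x within {0..x+1} = at x within {0..}"
      by (rule at_within_nhd[of _ "{..<x+1}"]) auto
    ultimately show ?thesis by simp
  qed
  have dxu: "dx u x = p x" if "x \<ge> 0" for x
    by (rule dx_eq[OF du]) (use that in auto)
  have acp: "absolutely_continuous_on 0 R p" for R
    unfolding p_def[abs_def] by (rule absolutely_continuous_on_indefinite_integral[OF gai])
  have "absolutely_continuous_on 0 R (\<lambda>x. a + integral {0..x} p)" for R
    by (intro absolutely_continuous_on_indefinite_integral absolutely_integrable_continuous_real pc)
  then have "locally_AC u"
    unfolding locally_AC_def using up absolutely_continuous_on_cong[of 0 _ u "\<lambda>x. a + integral {0..x} p"] by auto
  moreover have "locally_AC (dx u)"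
    unfolding locally_AC_def using dxu acp absolutely_continuous_on_cong[of 0 _ "dx u" p] by auto
  ultimately show "u \<in> W21_loc"
    using du by (auto simp: W21_loc_def intro: differentiableI_vector)
  obtain N where N: "negligible N"
    "\<And>x. x > 0 \<Longrightarrow> x \<notin> N \<Longrightarrow> ((\<lambda>x. integral {0..x} g) has_vector_derivative g x) (at x)"
    by (rule Lebesgue_differentiation_indefinite_integral[OF gi]) blast
  have d: "dx (dx u) x = g x" if x: "x > 0" "x \<notin> N" for x
  proof (rule dx_eq)
    have "(p has_vector_derivative g x) (at x within {0..})"
      unfolding p_def by (auto intro!: derivative_eq_intros has_vector_derivative_at_within[OF N(2)[OF x]])
    then show "(dx u has_vector_derivative g x) (at x within {0..})"
      by (rule has_vector_derivative_transform[rotated 2]) (use x dxu in auto)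
  qed (use x in auto)
  \<comment> \<open>The differentiation theorem is two-sided and covers only x > 0, so the point 0
    joins the null set.\<close>
  have "AE x in lebesgue. x \<notin> insert 0 N"
    using N(1) by (intro AE_not_in) (simp add: negligible_iff_null_sets[symmetric])
  then have "AE x in lebesgue. x \<in> {0..} \<longrightarrow> dx (dx u) x = g x"
    by eventually_elim (use d in auto)
  then show "AE x in lebesgue_on {0..}. dx (dx u) x = g x"
    by (subst AE_restrict_space_iff) auto
qed

text \<open>No integrability is assumed: the substitution preserves it in both directions, and where
  it fails both integrals have the default value 0.\<close>

lemma integral_affine_real:
  fixes f :: "real \<Rightarrow> 'a::euclidean_space"
  assumes "m > 0"
  shows "integral {a..b} (\<lambda>x. f (m * x + c)) = (1 / m) *\<^sub>R integral {m * a + c..m * b + c} f"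
proof -
  have iff: "((\<lambda>x. f (m * x + c)) has_integral (I /\<^sub>R m)) {a..b} \<longleftrightarrow> (f has_integral I) {m * a + c..m * b + c}" for I
    using has_integral_affinity_iff[OF assms, of f c I "m * a + c" "m * b + c"] assms
    by (simp add: mult.assoc[symmetric])
  show ?thesis
  proof (cases "f integrable_on {m * a + c..m * b + c}")
    case True
    then have "((\<lambda>x. f (m * x + c)) has_integral (integral {m * a + c..m * b + c} f /\<^sub>R m)) {a..b}"
      unfolding iff by (rule integrable_integral)
    then show ?thesis by (simp add: integral_unique divide_inverse_commute)
  next
    case False
    have "\<not> (\<lambda>x. f (m * x + c)) integrable_on {a..b}"
    proof
      assume "(\<lambda>x. f (m * x + c)) integrable_on {a..b}"
      then obtain I where "((\<lambda>x. f (m * x + c)) has_integral I) {a..b}" by (auto simp: integrable_on_def)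
      then have "((\<lambda>x. f (m * x + c)) has_integral ((m *\<^sub>R I) /\<^sub>R m)) {a..b}" using assms by simp
      then show False using False unfolding iff by (auto simp: integrable_on_def)
    qed
    with False show ?thesis by (simp add: not_integrable_integral)
  qed
qed

section \<open>Square-integrable functions\<close>

lemma L2_norm_cong:
  assumes "\<And>x. x \<ge> 0 \<Longrightarrow> y x = z x"
  shows "L2_norm y = L2_norm z"
  unfolding L2_norm_def
  by (intro arg_cong[where f=sqrt] Bochner_Integration.integral_cong) (auto simp: assms)

lemma L2_cong:
  assumes "\<And>x. x \<ge> 0 \<Longrightarrow> y x = z x"
  shows "y \<in> L2 \<longleftrightarrow> z \<in> L2"
proof -
  have "y \<in> borel_measurable (lebesgue_on {0..}) \<longleftrightarrow> z \<in> borel_measurable (lebesgue_on {0..})"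
    by (rule measurable_cong) (auto simp: assms)
  moreover have "integrable (lebesgue_on {0..}) (\<lambda>x. (norm (y x))\<^sup>2) \<longleftrightarrow> integrable (lebesgue_on {0..}) (\<lambda>x. (norm (z x))\<^sup>2)"
    by (rule Bochner_Integration.integrable_cong) (auto simp: assms)
  ultimately show ?thesis by (simp add: L2_def)
qed

lemma integrable_indicator_Icc_half_line:
  "integrable (lebesgue_on {0..}) (\<lambda>x. c * indicator {0..T} x :: real)"
  "(\<integral>x. c * indicator {0..T} x \<partial>lebesgue_on {0..}) = c * max T 0"
proof -
  have s: "{0..T} \<in> sets (lebesgue_on {0..})"
    by (auto simp: sets_restrict_space image_iff intro!: bexI[of _ "{0..T}"])
  have e: "emeasure (lebesgue_on {0..}) {0..T} = ennreal (max T 0)"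
    by (subst emeasure_restrict_space) (auto simp: emeasure_lborel_Icc_eq max_def ennreal_neg)
  have "integrable (lebesgue_on {0..}) (indicat_real {0..T})"
    using s e by (intro integrable_real_indicator) auto
  then show "integrable (lebesgue_on {0..}) (\<lambda>x. c * indicator {0..T} x :: real)" by simp
  have "measure (lebesgue_on {0..}) {0..T} = max T 0"
    using e by (simp add: measure_def)
  moreover have "{0..T} \<inter> space (lebesgue_on {0..}) = {0..T}" by auto
  ultimately show "(\<integral>x. c * indicator {0..T} x \<partial>lebesgue_on {0..}) = c * max T 0" by simp
qed

lemma L2_norm_le:
  assumes T: "T \<ge> 0" and C: "C \<ge> 0"
    and b: "\<And>x. x \<in> {0..T} \<Longrightarrow> norm (y x) \<le> C" and z: "\<And>x. x > T \<Longrightarrow> y x = 0"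
  shows "L2_norm y \<le> C * sqrt T"
proof -
  have "(\<integral>x. (norm (y x))\<^sup>2 \<partial>lebesgue_on {0..}) \<le> (\<integral>x. C\<^sup>2 * indicator {0..T} x \<partial>lebesgue_on {0..})"
  proof (rule integral_mono'[OF integrable_indicator_Icc_half_line(1)])
    fix x assume "x \<in> space (lebesgue_on {0::real..})"
    then show "(norm (y x))\<^sup>2 \<le> C\<^sup>2 * indicator {0..T} x"
      using b[of x] z[of x] by (cases "x \<le> T") (auto intro: power_mono)
  qed simp
  also have "\<dots> = C\<^sup>2 * T" using T integrable_indicator_Icc_half_line(2)[of "C\<^sup>2" T] by simp
  finally show ?thesis
    unfolding L2_norm_def using C T by (metis real_sqrt_le_mono real_sqrt_mult real_sqrt_abs abs_of_nonneg)
qed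

lemma L2_of_bounded_support:
  assumes "y \<in> borel_measurable (lebesgue_on {0..})"
    and b: "\<And>x. x \<in> {0..T} \<Longrightarrow> norm (y x) \<le> C" and z: "\<And>x. x > T \<Longrightarrow> y x = 0"
  shows "y \<in> L2"
proof -
  have "integrable (lebesgue_on {0..}) (\<lambda>x. (norm (y x))\<^sup>2)"
  proof (rule Bochner_Integration.integrable_bound[OF integrable_indicator_Icc_half_line(1)])
    show "(\<lambda>x. (norm (y x))\<^sup>2) \<in> borel_measurable (lebesgue_on {0..})"
      using assms(1) by measurable
    show "AE x in lebesgue_on {0..}. norm ((norm (y x))\<^sup>2) \<le> norm (C\<^sup>2 * indicat_real {0..T} x)"
    proof (intro AE_I2)
      fix x assume "x \<in> space (lebesgue_on {0::real..})"
      then show "norm ((norm (y x))\<^sup>2) \<le> norm (C\<^sup>2 * indicat_real {0..T} x)"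
        using b[of x] z[of x] by (cases "x \<le> T") (auto intro: power_mono)
    qed
  qed
  then show ?thesis using assms(1) by (simp add: L2_def)
qed

lemma L2_of_continuous_bounded_support:
  fixes y :: "real \<Rightarrow> complex ^ 'n"
  assumes c: "continuous_on {0..} y" and z: "\<And>x. x > T \<Longrightarrow> y x = 0"
  shows "y \<in> L2"
proof -
  have "compact (y ` {0..T})"
    by (intro compact_continuous_image continuous_on_subset[OF c]) auto
  then have "bounded (y ` {0..T})" by (rule compact_imp_bounded)
  then obtain C where "\<And>x. x \<in> {0..T} \<Longrightarrow> norm (y x) \<le> C"
    unfolding bounded_iff by blast
  moreover have "y \<in> borel_measurable (lebesgue_on {0..})"
    by (rule continuous_imp_measurable_on_sets_lebesgue[OF c]) auto
  ultimately show ?thesis using z by (intro L2_of_bounded_support[of y T C])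
qed

text \<open>For times in [0,T] everything vanishes for x > T, so the norm in \<open>L2\<close> is at
  most sqrt T times a supremum over [0,T]. Uniform continuity of D on the square with side [0,T] and
  the mean value inequality make the difference quotients converge uniformly.\<close>

lemma has_L2_derivative_of_pointwise:
  fixes U D :: "real \<Rightarrow> real \<Rightarrow> complex ^ 'n"
  assumes T: "T \<ge> 0" and S: "S \<subseteq> {0..T}" and t: "t \<in> S"
    and D: "continuous_on UNIV (\<lambda>p. D (fst p) (snd p))"
    and der: "\<And>x t. x \<ge> 0 \<Longrightarrow> (U x has_vector_derivative D x t) (at t)"
    and z: "\<And>x t. 0 \<le> x \<Longrightarrow> t \<le> x \<Longrightarrow> U x t = 0" "\<And>x t. 0 \<le> x \<Longrightarrow> t \<le> x \<Longrightarrow> D x t = 0"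
  shows "has_L2_derivative (\<lambda>s x. U x s) (\<lambda>x. D x t) t S"
  unfolding has_L2_derivative_def
proof
  have tT: "0 \<le> t" "t \<le> T" using S t by auto
  show "(\<lambda>x. D x t) \<in> L2"
  proof (rule L2_of_continuous_bounded_support[of _ T])
    show "continuous_on {0..} (\<lambda>x. D x t)"
      using continuous_on_compose2[OF D, of "{0..}" "\<lambda>x. (x, t)"] by (simp add: continuous_on_Pair)
    show "D x t = 0" if "x > T" for x using z(2)[of x t] that tT by auto
  qed
  show "((\<lambda>s. L2_norm (\<lambda>x. (1 / (s - t)) *\<^sub>R (U x s - U x t) - D x t)) \<longlongrightarrow> 0) (at t within S)"
  proof (rule tendstoI)
    fix e :: real assume e: "e > 0"
    \<comment> \<open>The summand 1 yields the strict inequality e' * sqrt T < e and keeps the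
      denominator positive for T = 0.\<close>
    define e' where "e' = e / (sqrt T + 1)"
    have sT: "sqrt T \<ge> 0" using T by simp
    then have e': "e' > 0" using e by (simp add: e'_def add_nonneg_pos)
    have "uniformly_continuous_on ({0..T} \<times> {0..T}) (\<lambda>p. D (fst p) (snd p))"
      by (intro compact_uniformly_continuous continuous_on_subset[OF D] compact_Times) auto
    then obtain d where d: "d > 0" "\<And>x s s'. x \<in> {0..T} \<Longrightarrow> s \<in> {0..T} \<Longrightarrow> s' \<in> {0..T} \<Longrightarrow> dist s' s < d \<Longrightarrow>
        dist (D x s') (D x s) < e'"
      using e' unfolding uniformly_continuous_on_def by (fastforce simp: dist_Pair_Pair)
    have "L2_norm (\<lambda>x. (1 / (s - t)) *\<^sub>R (U x s - U x t) - D x t) \<le> e' * sqrt T"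
      if s: "s \<in> S" "s \<noteq> t" "dist s t < d" for s
    proof (rule L2_norm_le[OF T])
      have sT: "0 \<le> s" "s \<le> T" using s S by auto
      fix x assume x: "x \<in> {0..T}"
      have "norm (U x s - U x t - (s - t) *\<^sub>R D x t) \<le> norm (s - t) * e'"
      proof (rule vector_differentiable_bound_linearization[of "closed_segment t s" "U x"])
        show "(U x has_vector_derivative D x r) (at r within closed_segment t s)" for r
          using der[of x r] x by (auto intro: has_vector_derivative_at_within)
        fix r assume r: "r \<in> closed_segment t s"
        then have "r \<in> {0..T}" "dist r t < d"
          using tT sT s by (auto simp: closed_segment_eq_real_ivl dist_real_def split: if_splits)
        then show "norm (D x r - D x t) \<le> e'"
          using d(2)[of x t r] x tT by (auto simp: dist_norm)
      qed auto
      moreover have "(1 / (s - t)) *\<^sub>R (U x s - U x t) - D x t = (1 / (s - t)) *\<^sub>R (U x s - U x t - (s - t) *\<^sub>R D x t)"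
        using s by (simp add: scaleR_diff_right)
      ultimately show "norm ((1 / (s - t)) *\<^sub>R (U x s - U x t) - D x t) \<le> e'"
        using s by (simp add: divide_le_eq mult.commute)
    next
      fix x assume "x > T"
      then show "(1 / (s - t)) *\<^sub>R (U x s - U x t) - D x t = 0"
        using z(1)[of x s] z(1)[of x t] z(2)[of x t] s S tT T by (auto simp: subset_iff)
    qed (use e' in auto)
    moreover have "e' * sqrt T < e"
    proof -
      have "e' * sqrt T < e' * (sqrt T + 1)" using e' by (intro mult_strict_left_mono) auto
      moreover have "sqrt T + 1 \<noteq> 0" using sT by linarith
      then have "e' * (sqrt T + 1) = e" by (simp add: e'_def)
      ultimately show ?thesis by simp
    qed
    moreover have "L2_norm y \<ge> 0" for y :: "real \<Rightarrow> complex ^ 'n"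
      unfolding L2_norm_def by (auto intro!: integral_nonneg_AE)
    ultimately have "\<And>s. s \<in> S \<Longrightarrow> s \<noteq> t \<Longrightarrow> dist s t < d \<Longrightarrow>
        dist (L2_norm (\<lambda>x. (1 / (s - t)) *\<^sub>R (U x s - U x t) - D x t)) 0 < e"
      by (fastforce simp: dist_real_def)
    then show "\<forall>\<^sub>F s in at t within S. dist (L2_norm (\<lambda>x. (1 / (s - t)) *\<^sub>R (U x s - U x t) - D x t)) 0 < e"
      unfolding eventually_at using d(1) by blast
  qed
qed

section \<open>Extension of the control\<close>

text \<open>For negative s the integral runs over an empty interval and is 0, in agreement with
  \<phi> = 0 there. Moving the lower limit to \<open>M\<close>, which lies below both 0 and s, makes
  s an interior point, so the derivative is two-sided.\<close>

lemma has_vector_derivative_indefinite_integral: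
  fixes \<phi> :: "real \<Rightarrow> 'a::euclidean_space"
  assumes c: "continuous_on UNIV \<phi>" and z: "\<And>s. s \<le> 0 \<Longrightarrow> \<phi> s = 0"
  shows "((\<lambda>s. integral {0..s} \<phi>) has_vector_derivative \<phi> s) (at s)"
proof -
  define M where "M = - \<bar>s\<bar> - 1"
  have M: "M < 0" "M < s" by (auto simp: M_def)
  have i: "\<phi> integrable_on {a..b}" for a b
    by (intro integrable_continuous_real continuous_on_subset[OF c]) auto
  have z': "integral {M..y} \<phi> = 0" if "y \<le> 0" for y
  proof -
    have "integral {M..y} \<phi> = integral {M..y} (\<lambda>_. 0)"
      by (rule integral_cong) (use z that in auto)
    then show ?thesis by simp
  qed
  have eq: "integral {M..y} \<phi> = integral {0..y} \<phi>" for y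
  proof (cases "y \<ge> 0")
    case True
    have "integral {M..0} \<phi> + integral {0..y} \<phi> = integral {M..y} \<phi>"
      using True M i by (intro Henstock_Kurzweil_Integration.integral_combine) auto
    then show ?thesis using z'[of 0] by simp
  next
    case False
    then show ?thesis using z'[of y] by simp
  qed
  have "((\<lambda>y. integral {M..y} \<phi>) has_vector_derivative \<phi> s) (at s within {M..s+1})"
    using M by (intro integral_has_vector_derivative continuous_on_subset[OF c]) auto
  moreover have "at s within {M..s+1} = at s"
    using M by (intro at_within_interior) auto
  ultimately show ?thesis by (simp add: eq)
qed

lemma vector_derivative_zero_initial:
  fixes h h' :: "real \<Rightarrow> 'a::real_normed_vector"
  assumes "d \<le> T" "\<And>t. t \<in> {0..<d} \<Longrightarrow> h t = 0" "t \<in> {0..<d}"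
    and "(h has_vector_derivative h' t) (at t within {0..T})"
  shows "h' t = 0"
proof -
  have td: "at t within {0..T} = at t within {0..d}"
    by (rule at_within_nhd[of _ "{..<d}"]) (use assms in auto)
  have "((\<lambda>_. 0) has_vector_derivative h' t) (at t within {0..T})"
    by (rule has_vector_derivative_transform_within[OF assms(4), of "d - t"]) (use assms in \<open>auto simp: dist_real_def\<close>)
  moreover have "((\<lambda>_. 0) has_vector_derivative (0::'a)) (at t within {0..T})"
    by simp
  ultimately show ?thesis
    using assms vector_derivative_unique_within_closed_interval[of 0 T t "\<lambda>_. 0" "h' t" 0] by auto
qed

text \<open>The second derivative of f is continued to the line and integrated three times from 0.
  By the support condition f and all its derivatives vanish near 0, so every integration constant is
  0 and the pieces fit together at 0. The integrations return f', f and an antiderivative of f on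
  [0,T]; the last one is what Duhamel's formula for f itself requires.\<close>

lemma smooth_control_extension:
  fixes f :: "real \<Rightarrow> complex ^ 'n"
  assumes T: "T > 0" and f: "smooth_on_Icc T f"
    and supp: "closure {t \<in> {0..T}. f t \<noteq> 0} \<subseteq> {0<..T}"
  obtains G :: "nat \<Rightarrow> real \<Rightarrow> complex ^ 'n" where
    "\<And>s. s \<le> T \<Longrightarrow> G 1 s = extend0 f s"
    "\<And>k s. k \<le> 3 \<Longrightarrow> s \<le> 0 \<Longrightarrow> G k s = 0"
    "\<And>k s. k < 3 \<Longrightarrow> (G k has_vector_derivative G (Suc k) s) (at s)"
    "\<And>k. k \<le> 3 \<Longrightarrow> continuous_on UNIV (G k)"
proof -
  obtain D :: "nat \<Rightarrow> real \<Rightarrow> complex ^ 'n" where D0: "\<And>t. t \<in> {0..T} \<Longrightarrow> D 0 t = f t"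
    and D: "\<And>k t. t \<in> {0..T} \<Longrightarrow> (D k has_vector_derivative D (Suc k) t) (at t within {0..T})"
    using f unfolding smooth_on_Icc_def by blast
  have "0 \<notin> closure {t \<in> {0..T}. f t \<noteq> 0}" using supp by auto
  then obtain d0 where d0: "d0 > 0" "\<And>t. t \<in> {0..T} \<Longrightarrow> f t \<noteq> 0 \<Longrightarrow> \<not> dist t 0 < d0"
    unfolding closure_approachable by blast
  define d where "d = min d0 T"
  have d: "d > 0" "d \<le> T" "\<And>t. t \<in> {0..<d} \<Longrightarrow> f t = 0"
    using d0 T by (force simp: d_def dist_real_def)+
  have Dz: "D k t = 0" if "t \<in> {0..<d}" for k t
    using that
  proof (induction k arbitrary: t)
    case 0 then show ?case using d D0[of t] by auto
  next
    case (Suc k)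
    show ?case
      by (rule vector_derivative_zero_initial[of d T "D k" t "D (Suc k)"]) (use Suc d D in auto)
  qed
  have Dc: "continuous_on {0..T} (D k)" for k
    using D by (intro continuous_on_vector_derivative) blast
  \<comment> \<open>f'' frozen at its end values, 0 on the left and f''(T) on the right, hence
    continuous on the line.\<close>
  define \<phi> where "\<phi> s = D 2 (max 0 (min s T))" for s
  define \<phi>1 where "\<phi>1 s = integral {0..s} \<phi>" for s
  define \<phi>2 where "\<phi>2 s = integral {0..s} \<phi>1" for s
  define \<phi>3 where "\<phi>3 s = integral {0..s} \<phi>2" for s
  have c: "continuous_on UNIV \<phi>"
    unfolding \<phi>_def using T by (intro continuous_on_compose2[OF Dc] continuous_intros) auto
  have z: "\<phi> s = 0" if "s \<le> 0" for s
    using that T Dz[of 0 2] d by (simp add: \<phi>_def)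
  have z1: "\<phi>1 s = 0" and z2: "\<phi>2 s = 0" and z3: "\<phi>3 s = 0" if "s \<le> 0" for s
    using that by (cases "s = 0"; simp add: \<phi>1_def \<phi>2_def \<phi>3_def)+
  have d1: "(\<phi>1 has_vector_derivative \<phi> s) (at s)" for s
    unfolding \<phi>1_def by (rule has_vector_derivative_indefinite_integral[OF c z])
  have c1: "continuous_on UNIV \<phi>1"
    using d1 by (intro continuous_on_vector_derivative) auto
  have d2: "(\<phi>2 has_vector_derivative \<phi>1 s) (at s)" for s
    unfolding \<phi>2_def by (rule has_vector_derivative_indefinite_integral[OF c1 z1])
  have c2: "continuous_on UNIV \<phi>2"
    using d2 by (intro continuous_on_vector_derivative) auto
  have d3: "(\<phi>3 has_vector_derivative \<phi>2 s) (at s)" for s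
    unfolding \<phi>3_def by (rule has_vector_derivative_indefinite_integral[OF c2 z2])
  have c3: "continuous_on UNIV \<phi>3"
    using d3 by (intro continuous_on_vector_derivative) auto
  have ftc: "integral {0..s} h = D k s"
    if "s \<in> {0..T}" "\<And>r. r \<in> {0..T} \<Longrightarrow> h r = D (Suc k) r" for k s h
  proof -
    have "(D (Suc k) has_integral D k s - D k 0) {0..s}"
      by (rule fundamental_theorem_of_calculus)
        (use that in \<open>auto intro!: has_vector_derivative_within_subset[OF D]\<close>)
    then have "integral {0..s} (D (Suc k)) = D k s" using Dz[of 0 k] d by (simp add: integral_unique)
    moreover have "integral {0..s} h = integral {0..s} (D (Suc k))"
      by (rule integral_cong) (use that in auto)
    ultimately show ?thesis by simp
  qed
  have e1: "\<phi>1 s = D 1 s" if "s \<in> {0..T}" for s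
    unfolding \<phi>1_def by (rule ftc[OF that]) (auto simp: \<phi>_def numeral_2_eq_2)
  have e2: "\<phi>2 s = D 0 s" if "s \<in> {0..T}" for s
    unfolding \<phi>2_def by (rule ftc[OF that]) (use e1 in auto)
  \<comment> \<open>Index shift by one: up to index 3, \<open>G k\<close> is on [0,T] the derivative
    of f of order k - 1, where order -1 stands for an antiderivative.\<close>
  define G where "G k = (if k = 0 then \<phi>3 else if k = 1 then \<phi>2 else if k = 2 then \<phi>1 else \<phi>)" for k :: nat
  show ?thesis
  proof (rule that[of G])
    show "G 1 s = extend0 f s" if "s \<le> T" for s
      using that e2[of s] D0[of s] z2[of s] by (cases "s < 0") (auto simp: G_def extend0_def)
    show "G k s = 0" if "k \<le> 3" "s \<le> 0" for k s
      using that z z1 z2 z3 by (simp add: G_def)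
    show "(G k has_vector_derivative G (Suc k) s) (at s)" if "k < 3" for k s
    proof -
      from that consider "k = 0" | "k = 1" | "k = 2" by linarith
      then show ?thesis
        by cases (use d1[of s] d2[of s] d3[of s] in \<open>simp_all add: G_def\<close>)
    qed
    show "continuous_on UNIV (G k)" for k
      using c c1 c2 c3 by (simp add: G_def)
  qed
qed

section \<open>The wave generated by a control\<close>

text \<open>
  The substitution \<open>s = x + r\<close> in the definition of \<^const>\<open>wave\<close> with \<open>k x r = w(x, x + r)\<close>. The upper limit
  \<open>t - x\<close> may be replaced by \<open>T\<close> since \<open>G\<close> vanishes on the negative half-line.
\<close>

definition wave_map ::
  "(real \<Rightarrow> real \<Rightarrow> complex ^ 'n ^ 'n) \<Rightarrow> real \<Rightarrow> (real \<Rightarrow> complex ^ 'n) \<Rightarrow> real \<Rightarrow> real \<Rightarrow> complex ^ 'n" where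
  "wave_map k T G x t = G (t - x) + integral {0..T} (\<lambda>r. k x r *v G (t - x - r))"

lemma has_vector_derivative_compose_affine:
  fixes G :: "real \<Rightarrow> 'a::real_normed_vector"
  assumes "(G has_vector_derivative D) (at (m * t + c))"
  shows "((\<lambda>t. G (m * t + c)) has_vector_derivative m *\<^sub>R D) (at t)"
proof -
  have "((\<lambda>t. m * t + c) has_real_derivative m) (at t)"
    by (auto intro!: derivative_eq_intros)
  then have "((\<lambda>t. m * t + c) has_vector_derivative m) (at t)"
    by (simp add: has_real_derivative_iff_has_vector_derivative)
  from vector_diff_chain_at[OF this assms] show ?thesis by (simp add: o_def)
qed

lemma continuous_on_matrix_vector_mult [continuous_intros]:
  fixes A :: "'a::topological_space \<Rightarrow> complex ^ 'n ^ 'm"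
  assumes "continuous_on S A" "continuous_on S y"
  shows "continuous_on S (\<lambda>x. A x *v y x)"
  using bounded_bilinear.continuous_on[OF bounded_bilinear_matrix_vector_mult assms] .

lemma continuous_on_curried:
  assumes "continuous_on UNIV (\<lambda>p. k (fst p) (snd p))" "continuous_on S a" "continuous_on S b"
  shows "continuous_on S (\<lambda>x. k (a x) (b x))"
  using continuous_on_compose2[OF assms(1) continuous_on_Pair[OF assms(2,3)]] by simp

lemma continuous_on_wave_map:
  assumes k: "continuous_on UNIV (\<lambda>p. k (fst p) (snd p))" and G: "continuous_on UNIV G"
  shows "continuous_on UNIV (\<lambda>p. wave_map k T G (fst p) (snd p))"
proof -
  have "continuous_on UNIV (\<lambda>p. integral (cbox 0 T) (\<lambda>r. k (fst p) r *v G (snd p - fst p - r)))"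
  proof (rule integral_continuous_on_param)
    show "continuous_on (UNIV \<times> cbox 0 T) (\<lambda>(p, r). k (fst p) r *v G (snd p - fst p - r))"
      unfolding split_beta
      by (intro continuous_intros continuous_on_curried[OF k] continuous_on_compose2[OF G]) auto
  qed
  then show ?thesis
    unfolding wave_map_def by (intro continuous_intros continuous_on_compose2[OF G]) auto
qed

lemma wave_map_eq_0:
  assumes "\<And>s. s \<le> 0 \<Longrightarrow> G s = 0" "t \<le> x"
  shows "wave_map k T G x t = 0"
proof -
  have "integral {0..T} (\<lambda>r. k x r *v G (t - x - r)) = integral {0..T} (\<lambda>r. 0)"
    by (rule integral_cong) (use assms in auto)
  then show ?thesis using assms by (simp add: wave_map_def)
qed

text \<open>In the variable r the limits are fixed and the kernel is free of t, so the time
  derivative falls on G alone. All regularity in t thus comes from the control and none from the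
  kernel.\<close>

lemma has_vector_derivative_wave_map:
  assumes k: "continuous_on UNIV (\<lambda>p. k (fst p) (snd p))"
    and G: "\<And>s. (G has_vector_derivative G' s) (at s)" and G': "continuous_on UNIV G'"
  shows "(wave_map k T G x has_vector_derivative wave_map k T G' x t) (at t)"
proof -
  have Gc: "continuous_on UNIV G"
    using G by (intro continuous_on_vector_derivative) auto
  have sh: "((\<lambda>t. G (t - c)) has_vector_derivative G' (t - c)) (at t)" for c t
    using has_vector_derivative_compose_affine[of G "G' (t - c)" 1 t "- c"] G[of "t - c"] by simp
  have "((\<lambda>t. integral (cbox 0 T) (\<lambda>r. k x r *v G (t - x - r))) has_vector_derivative
      integral (cbox 0 T) (\<lambda>r. k x r *v G' (t - x - r))) (at t within UNIV)"
  proof (rule leibniz_rule_vector_derivative[where U=UNIV])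
    show "((\<lambda>t. k x r *v G (t - x - r)) has_vector_derivative k x r *v G' (t - x - r)) (at t within UNIV)" for t r
      using bounded_linear.has_vector_derivative[OF matrix_vector_mul_bounded_linear[of "k x r"] sh[of "x + r" t]]
      by (simp add: algebra_simps)
    show "(\<lambda>r. k x r *v G (t - x - r)) integrable_on cbox 0 T" for t
      by (intro integrable_continuous continuous_intros continuous_on_curried[OF k] continuous_on_compose2[OF Gc]) auto
    show "continuous_on (UNIV \<times> cbox 0 T) (\<lambda>(t, r). k x r *v G' (t - x - r))"
      unfolding split_beta
      by (intro continuous_intros continuous_on_curried[OF k] continuous_on_compose2[OF G']) auto
  qed auto
  then show ?thesis
    unfolding wave_map_def[abs_def] using sh[of x t] by (auto intro!: has_vector_derivative_add)
qed

lemma wave_eq_wave_map: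
  assumes k: "\<And>x r. 0 \<le> x \<Longrightarrow> 0 \<le> r \<Longrightarrow> k x r = v r (r + 2 * x)"
    and f: "\<And>s. s \<le> T \<Longrightarrow> G s = extend0 f s" and z: "\<And>s. s \<le> 0 \<Longrightarrow> G s = 0"
    and x: "0 \<le> x" and t: "t \<le> T"
  shows "wave (kernel_w v) f x t = wave_map k T G x t"
proof (cases "t < x")
  case True
  then show ?thesis
    using wave_map_eq_0[of G t x k T] z by (simp add: wave_def extend0_def)
next
  case False
  have "integral {x..t} (\<lambda>s. kernel_w v x s *v extend0 f (t - s)) = integral {0..t - x} (\<lambda>r. kernel_w v x (r + x) *v extend0 f (t - (r + x)))"
    using integral_affine_real[of 1 0 "t - x" "\<lambda>s. kernel_w v x s *v extend0 f (t - s)" x] by simp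
  also have "\<dots> = integral {0..t - x} (\<lambda>r. k x r *v G (t - x - r))"
    by (rule integral_cong) (use x t f in \<open>auto simp: kernel_w_def k algebra_simps\<close>)
  also have "\<dots> = integral {0..T} (\<lambda>r. if r \<in> {0..t - x} then k x r *v G (t - x - r) else 0)"
    using x t by (subst integral_restrict_Int) (auto simp: Int_absorb2)
  also have "\<dots> = integral {0..T} (\<lambda>r. k x r *v G (t - x - r))"
    by (rule integral_cong) (use z in auto)
  finally show ?thesis
    using False x t f by (simp add: wave_def wave_map_def)
qed

section \<open>Moving windows of integration and the kernel in characteristic coordinates\<close>

lemma continuous_rectangle_bound:
  fixes h :: "real \<Rightarrow> real \<Rightarrow> 'a::real_normed_vector"
  assumes "continuous_on UNIV (\<lambda>p. h (fst p) (snd p))"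
  obtains C where "C \<ge> 0" "\<And>y z. y \<in> {a..b} \<Longrightarrow> z \<in> {c..d} \<Longrightarrow> norm (h y z) \<le> C"
proof -
  have "compact ((\<lambda>p. h (fst p) (snd p)) ` ({a..b} \<times> {c..d}))"
    by (intro compact_continuous_image continuous_on_subset[OF assms] compact_Times) auto
  then have "bounded ((\<lambda>p. h (fst p) (snd p)) ` ({a..b} \<times> {c..d}))" by (rule compact_imp_bounded)
  then obtain C where C: "\<And>p. p \<in> {a..b} \<times> {c..d} \<Longrightarrow> norm (h (fst p) (snd p)) \<le> C"
    unfolding bounded_iff by blast
  show ?thesis
  proof (rule that[of "max C 0"])
    fix y z assume "y \<in> {a..b}" "z \<in> {c..d}"
    then show "norm (h y z) \<le> max C 0" using C[of "(y, z)"] by auto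
  qed simp
qed

text \<open>The moving window is mapped affinely onto [0,1], so its end points enter the integrand
  instead of the domain. The length is cut off at 0 for empty windows, which makes the right-hand
  side continuous in a and b when h is continuous.\<close>

lemma integral_window_eq:
  fixes h :: "real \<Rightarrow> 'a::euclidean_space" and T :: real
  defines "lo \<equiv> \<lambda>a. max 0 a" and "len \<equiv> \<lambda>a b. max 0 (min T b - max 0 a)"
  shows "integral {0..T} (\<lambda>\<rho>. if a \<le> \<rho> \<and> \<rho> \<le> b then h \<rho> else 0) =
    len a b *\<^sub>R integral {0..1} (\<lambda>s. h (len a b * s + lo a))"
proof -
  have "integral {0..T} (\<lambda>\<rho>. if a \<le> \<rho> \<and> \<rho> \<le> b then h \<rho> else 0) = integral {0..T} (\<lambda>\<rho>. if \<rho> \<in> {a..b} then h \<rho> else 0)"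
    by simp
  also have "\<dots> = integral {lo a..min T b} h"
    unfolding integral_restrict_Int by (intro arg_cong[where f="\<lambda>S. integral S h"]) (auto simp: lo_def)
  also have "\<dots> = len a b *\<^sub>R integral {0..1} (\<lambda>s. h (len a b * s + lo a))"
  proof (cases "lo a < min T b")
    case True
    then have "len a b > 0" "lo a + len a b = min T b" by (auto simp: lo_def len_def)
    then show ?thesis
      using integral_affine_real[of "len a b" 0 1 h "lo a"] by (simp add: add.commute)
  next
    case False
    then have "len a b = 0" by (auto simp: lo_def len_def)
    moreover have "integral {lo a..min T b} h = 0"
      using False by (cases "lo a = min T b") auto
    ultimately show ?thesis by simp
  qed
  finally show ?thesis .
qed

lemma continuous_on_integral_window:
  fixes h :: "real \<Rightarrow> real \<Rightarrow> 'a::euclidean_space"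
  assumes h: "continuous_on UNIV (\<lambda>p. h (fst p) (snd p))"
    and a: "continuous_on UNIV (\<lambda>p. a (fst p) (snd p))" and b: "continuous_on UNIV (\<lambda>p. b (fst p) (snd p))"
  shows "continuous_on UNIV (\<lambda>p. integral {0..T} (\<lambda>\<rho>. if a (fst p) (snd p) \<le> \<rho> \<and> \<rho> \<le> b (fst p) (snd p) then h (fst p) \<rho> else 0))"
proof -
  let ?l = "\<lambda>p. max 0 (min T (b (fst p) (snd p)) - max 0 (a (fst p) (snd p)))"
  let ?a = "\<lambda>p. max 0 (a (fst p) (snd p))"
  have l: "continuous_on UNIV ?l" and a': "continuous_on UNIV ?a"
    by (intro continuous_intros a b)+
  have "continuous_on UNIV (\<lambda>p. integral (cbox 0 1) (\<lambda>s. h (fst p) (?l p * s + ?a p)))"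
  proof (rule integral_continuous_on_param)
    show "continuous_on (UNIV \<times> cbox 0 1) (\<lambda>(p, s). h (fst p) (?l p * s + ?a p))"
      unfolding split_beta
      by (intro continuous_on_curried[OF h] continuous_on_add continuous_on_mult continuous_on_compose2[OF l]
          continuous_on_compose2[OF a'] continuous_intros) auto
  qed
  then show ?thesis
    unfolding integral_window_eq by (intro continuous_intros a b) auto
qed

text \<open>As \<sigma> \<le> T, the function G vanishes at \<sigma> - r for all r \<ge> T.
  Replacing the upper limit b by \<open>min T b\<close> therefore leaves the boundary value
  unchanged, and for a window beyond T both boundary values are 0.\<close>

lemma integral_window_FTC:
  fixes G G' :: "real \<Rightarrow> 'a::euclidean_space"
  assumes G: "\<And>s. (G has_vector_derivative G' s) (at s)" and z: "\<And>s. s \<le> 0 \<Longrightarrow> G s = 0"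
    and ab: "0 \<le> a" "a \<le> b" and \<sigma>: "\<sigma> \<le> T"
  shows "integral {0..T} (\<lambda>r. if a \<le> r \<and> r \<le> b then G' (\<sigma> - r) else 0) = G (\<sigma> - a) - G (\<sigma> - b)"
proof -
  have "integral {0..T} (\<lambda>r. if a \<le> r \<and> r \<le> b then G' (\<sigma> - r) else 0) = integral {0..T} (\<lambda>r. if r \<in> {a..b} then G' (\<sigma> - r) else 0)"
    by simp
  also have "\<dots> = integral {a..min T b} (\<lambda>r. G' (\<sigma> - r))"
    unfolding integral_restrict_Int using ab by (intro arg_cong[where f="\<lambda>S. integral S (\<lambda>r. G' (\<sigma> - r))"]) auto
  also have "\<dots> = G (\<sigma> - a) - G (\<sigma> - b)"
  proof (cases "a \<le> T")
    case True
    have d: "((\<lambda>r. - G (\<sigma> - r)) has_vector_derivative G' (\<sigma> - r)) (at r)" for r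
      using has_vector_derivative_minus[OF has_vector_derivative_compose_affine[of G "G' (\<sigma> - r)" "- 1" r \<sigma>]] G[of "\<sigma> - r"]
      by simp
    have "((\<lambda>r. G' (\<sigma> - r)) has_integral - G (\<sigma> - min T b) - - G (\<sigma> - a)) {a..min T b}"
      by (rule fundamental_theorem_of_calculus) (use True ab in \<open>auto intro: has_vector_derivative_at_within[OF d]\<close>)
    moreover have "G (\<sigma> - min T b) = G (\<sigma> - b)"
      using z[of "\<sigma> - T"] z[of "\<sigma> - b"] \<sigma> by (cases "b \<le> T") auto
    ultimately show ?thesis by (simp add: integral_unique)
  next
    case False
    then show ?thesis using z[of "\<sigma> - a"] z[of "\<sigma> - b"] ab \<sigma> by simp
  qed
  finally show ?thesis .
qed

text \<open>The maxima in \<open>k\<close> only serve to extend the kernel continuously to the whole plane.\<close>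

lemma goursat_solution_characteristic:
  fixes v :: "real \<Rightarrow> real \<Rightarrow> complex ^ 'n ^ 'n"
  assumes v: "goursat_solution q v"
  defines "k \<equiv> \<lambda>x r. v (max 0 r) (max 0 r + 2 * max 0 x)"
  shows "continuous_on UNIV (\<lambda>p. k (fst p) (snd p))"
    and "\<And>x r. 0 \<le> x \<Longrightarrow> 0 \<le> r \<Longrightarrow> k x r = v r (r + 2 * x)"
    and "\<And>x r. 0 \<le> x \<Longrightarrow> 0 \<le> r \<Longrightarrow> k x r = - ((1/2) *\<^sub>R integral {r/2..r/2 + x} q)
      - (1/2) *\<^sub>R integral {0..r} (\<lambda>\<rho>. integral {(r - \<rho>)/2..(r - \<rho>)/2 + x} (\<lambda>y. q y ** k y \<rho>))"
proof -
  have vc: "continuous_on {(\<xi>, \<eta>). 0 \<le> \<xi> \<and> \<xi> \<le> \<eta>} (\<lambda>(\<xi>, \<eta>). v \<xi> \<eta>)"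
    and ve: "\<And>\<xi> \<eta>. 0 \<le> \<xi> \<Longrightarrow> \<xi> \<le> \<eta> \<Longrightarrow> v \<xi> \<eta> = - ((1/2) *\<^sub>R integral {\<xi>/2..\<eta>/2} q)
          - (1/4) *\<^sub>R integral {0..\<xi>} (\<lambda>\<xi>1. integral {\<xi>..\<eta>} (\<lambda>\<eta>1. q ((\<eta>1 - \<xi>1) / 2) ** v \<xi>1 \<eta>1))"
    using v unfolding goursat_solution_def by auto
  have "continuous_on UNIV (\<lambda>p::real\<times>real. (\<lambda>(\<xi>, \<eta>). v \<xi> \<eta>) (max 0 (snd p), max 0 (snd p) + 2 * max 0 (fst p)))"
    by (rule continuous_on_compose2[OF vc]) (auto intro!: continuous_intros)
  then show "continuous_on UNIV (\<lambda>p. k (fst p) (snd p))"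
    by (simp add: k_def)
  show kv: "k x r = v r (r + 2 * x)" if "0 \<le> x" "0 \<le> r" for x r
    using that by (simp add: k_def)
  show "k x r = - ((1/2) *\<^sub>R integral {r/2..r/2 + x} q)
      - (1/2) *\<^sub>R integral {0..r} (\<lambda>\<rho>. integral {(r - \<rho>)/2..(r - \<rho>)/2 + x} (\<lambda>y. q y ** k y \<rho>))"
    if x: "0 \<le> x" and r: "0 \<le> r" for x r
  proof -
    \<comment> \<open>The substitution \<eta> = 2 y + \<rho> makes y the argument of q and turns v
      into \<open>k y \<rho>\<close>. Its Jacobian 2 changes the factor 1/4 of the Goursat equation
      into 1/2.\<close>
    have inner: "integral {r..r + 2 * x} (\<lambda>\<eta>. q ((\<eta> - \<rho>) / 2) ** v \<rho> \<eta>) =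
        2 *\<^sub>R integral {(r - \<rho>)/2..(r - \<rho>)/2 + x} (\<lambda>y. q y ** k y \<rho>)" if "\<rho> \<in> {0..r}" for \<rho>
    proof -
      have "integral {(r - \<rho>)/2..(r - \<rho>)/2 + x} (\<lambda>y. q y ** k y \<rho>) =
          integral {(r - \<rho>)/2..(r - \<rho>)/2 + x} (\<lambda>y. q (((2 * y + \<rho>) - \<rho>) / 2) ** v \<rho> (2 * y + \<rho>))"
        by (rule integral_cong) (use that in \<open>auto simp: kv add.commute\<close>)
      also have "\<dots> = (1/2) *\<^sub>R integral {2 * ((r - \<rho>)/2) + \<rho>..2 * ((r - \<rho>)/2 + x) + \<rho>} (\<lambda>\<eta>. q ((\<eta> - \<rho>) / 2) ** v \<rho> \<eta>)"
        by (rule integral_affine_real) simp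
      also have "2 * ((r - \<rho>)/2) + \<rho> = r" by (simp add: field_simps)
      also have "2 * ((r - \<rho>)/2 + x) + \<rho> = r + 2 * x" by (simp add: field_simps)
      finally show ?thesis by simp
    qed
    have "integral {0..r} (\<lambda>\<rho>. integral {r..r + 2 * x} (\<lambda>\<eta>. q ((\<eta> - \<rho>) / 2) ** v \<rho> \<eta>)) =
       integral {0..r} (\<lambda>\<rho>. 2 *\<^sub>R integral {(r - \<rho>)/2..(r - \<rho>)/2 + x} (\<lambda>y. q y ** k y \<rho>))"
      by (rule integral_cong) (rule inner)
    then show ?thesis
      using ve[of r "r + 2 * x"] x r by (simp add: kv add_divide_distrib)
  qed
qed

section \<open>Duhamel's formula\<close>

lemma integral_matrix_vector_mult:
  fixes A :: "real \<Rightarrow> complex ^ 'n ^ 'm"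
  assumes "A integrable_on S"
  shows "integral S A *v w = integral S (\<lambda>y. A y *v w)"
proof -
  have "bounded_linear (\<lambda>A :: complex ^ 'n ^ 'm. A *v w)"
    by (rule bounded_bilinear.bounded_linear_left[OF bounded_bilinear_matrix_vector_mult])
  from integral_linear[OF assms this] show ?thesis by (simp add: o_def)
qed

text \<open>
  The window in \<open>J\<close> comes from the free term of the Goursat equation, the integral in \<open>J\<close> from its
  double integral after exchanging the order of integration.
\<close>

lemma characteristic_kernel_eq:
  fixes q k
  assumes q: "L1_loc (q :: real \<Rightarrow> complex ^ 'n ^ 'n)"
    and kc: "continuous_on UNIV (\<lambda>p. k (fst p) (snd p))"
    and k: "\<And>x r. 0 \<le> x \<Longrightarrow> 0 \<le> r \<Longrightarrow> k x r = - ((1/2) *\<^sub>R integral {r/2..r/2 + x} q)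
      - (1/2) *\<^sub>R integral {0..r} (\<lambda>\<rho>. integral {(r - \<rho>)/2..(r - \<rho>)/2 + x} (\<lambda>y. q y ** k y \<rho>))"
    and x: "0 \<le> x" and r: "r \<in> {0..T}" and Y: "T / 2 + x \<le> Y" "0 < Y"
  defines "J \<equiv> \<lambda>y. (if r/2 \<le> y \<and> y \<le> r/2 + x then mat 1 else 0) +
      integral {0..T} (\<lambda>\<rho>. if r - 2 * y \<le> \<rho> \<and> \<rho> \<le> r - 2 * max 0 (y - x) then k y \<rho> else 0)"
  shows "k x r = - ((1/2) *\<^sub>R integral {0..Y} (\<lambda>y. q y ** J y))"
    and "(\<lambda>y. q y ** J y) integrable_on {0..Y}"
proof -
  have qY: "q absolutely_integrable_on {0..Y}" using q Y by (auto simp: L1_loc_def)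
  note bb = bounded_bilinear_matrix_matrix_mult[where 'n='n and 'm='n and 'k='n]
  interpret B: bounded_bilinear "(**) :: complex ^ 'n ^ 'n \<Rightarrow> complex ^ 'n ^ 'n \<Rightarrow> _"
    by (fact bb)
  \<comment> \<open>The conditions (r - \<rho>)/2 \<le> y \<le> (r - \<rho>)/2 + x and \<rho> \<le>
    r, solved for \<rho>; the maximum with 0 encodes \<rho> \<le> r.\<close>
  define kk where "kk y \<rho> = (if r - 2 * y \<le> \<rho> \<and> \<rho> \<le> r - 2 * max 0 (y - x) then k y \<rho> else 0)" for y \<rho>
  define w :: "real \<Rightarrow> complex ^ 'n ^ 'n" where "w y = (if r/2 \<le> y \<and> y \<le> r/2 + x then mat 1 else 0)" for y
  have [measurable]: "(\<lambda>p. k (fst p) (snd p)) \<in> borel_measurable (borel \<Otimes>\<^sub>M borel)"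
    using borel_measurable_continuous_onI[OF kc] by (simp add: borel_prod)
  have kkm: "(\<lambda>p. kk (fst p) (snd p)) \<in> borel_measurable borel"
    unfolding kk_def borel_prod[symmetric] by measurable
  obtain C where C: "C \<ge> 0" "\<And>y z. y \<in> {0..Y} \<Longrightarrow> z \<in> {0..T} \<Longrightarrow> norm (k y z) \<le> C"
    using continuous_rectangle_bound[OF kc, of 0 Y 0 T] by blast
  have kkb: "norm (kk y z) \<le> C" if "y \<in> {0..Y}" "z \<in> {0..T}" for y z
    using C that by (auto simp: kk_def)
  note F = Fubini_bilinear[OF bb qY kkm kkb]
  have i2: "(\<lambda>y. q y ** integral {0..T} (kk y)) integrable_on {0..Y}"
    using F(3) set_lebesgue_integral_eq_integral(1) by blast
  have Jeq: "q y ** J y = q y ** w y + q y ** integral {0..T} (kk y)" for y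
    by (simp add: J_def w_def kk_def[abs_def] B.add_right)
  have weq: "q y ** w y = (if y \<in> {r/2..r/2 + x} then q y else 0)" for y
    by (auto simp: w_def)
  \<comment> \<open>The intervals of y that occur end at most at r/2 + x, and r \<le> T; this is why
    \<open>Y\<close> is at least T/2 + x.\<close>
  have sub: "{r/2..r/2 + x} \<subseteq> {0..Y}" using r Y by auto
  have i1: "(\<lambda>y. q y ** w y) integrable_on {0..Y}"
    unfolding weq integrable_restrict_Int
    using integrable_on_subinterval[of q "{0..Y}"] qY sub set_lebesgue_integral_eq_integral(1)
    by (metis inf.orderE integrable_on_subinterval set_lebesgue_integral_eq_integral(1))
  show "(\<lambda>y. q y ** J y) integrable_on {0..Y}"
    unfolding Jeq by (intro integrable_add i1 i2)
  have t1: "integral {0..Y} (\<lambda>y. q y ** w y) = integral {r/2..r/2 + x} q"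
    unfolding weq integral_restrict_Int by (simp only: Int_absorb2[OF sub])
  have inner: "(if \<rho> \<in> {0..r} then integral {(r - \<rho>)/2..(r - \<rho>)/2 + x} (\<lambda>y. q y ** k y \<rho>) else 0) =
      integral {0..Y} (\<lambda>y. q y ** kk y \<rho>)" if "\<rho> \<in> {0..T}" for \<rho>
  proof (cases "\<rho> \<le> r")
    case True
    have "integral {0..Y} (\<lambda>y. q y ** kk y \<rho>) =
      integral {0..Y} (\<lambda>y. if y \<in> {(r - \<rho>)/2..(r - \<rho>)/2 + x} then q y ** k y \<rho> else 0)"
      by (rule integral_cong) (use True in \<open>auto simp: kk_def max_def field_simps\<close>)
    also have "\<dots> = integral {(r - \<rho>)/2..(r - \<rho>)/2 + x} (\<lambda>y. q y ** k y \<rho>)"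
    proof -
      have "{(r - \<rho>)/2..(r - \<rho>)/2 + x} \<subseteq> {0..Y}"
        using True that r Y by (auto simp: field_simps)
      then show ?thesis
        unfolding integral_restrict_Int by (simp only: Int_absorb2)
    qed
    finally show ?thesis using True that by auto
  next
    case False
    then have "kk y \<rho> = 0" for y
      using max.cobounded1[of 0 "y - x"] by (auto simp: kk_def simp del: max.cobounded1)
    then show ?thesis using False by simp
  qed
  have "integral {0..r} (\<lambda>\<rho>. integral {(r - \<rho>)/2..(r - \<rho>)/2 + x} (\<lambda>y. q y ** k y \<rho>)) =
     integral {0..T} (\<lambda>\<rho>. if \<rho> \<in> {0..r} then integral {(r - \<rho>)/2..(r - \<rho>)/2 + x} (\<lambda>y. q y ** k y \<rho>) else 0)"
    unfolding integral_restrict_Int using r by (simp add: Int_absorb2)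
  also have "\<dots> = integral {0..T} (\<lambda>\<rho>. integral {0..Y} (\<lambda>y. q y ** kk y \<rho>))"
    by (rule integral_cong) (rule inner)
  also have "\<dots> = integral {0..Y} (\<lambda>y. q y ** integral {0..T} (kk y))"
    by (rule F(4))
  finally have t2: "integral {0..r} (\<lambda>\<rho>. integral {(r - \<rho>)/2..(r - \<rho>)/2 + x} (\<lambda>y. q y ** k y \<rho>)) =
     integral {0..Y} (\<lambda>y. q y ** integral {0..T} (kk y))" .
  have "integral {0..Y} (\<lambda>y. q y ** J y) = integral {r/2..r/2 + x} q +
     integral {0..r} (\<lambda>\<rho>. integral {(r - \<rho>)/2..(r - \<rho>)/2 + x} (\<lambda>y. q y ** k y \<rho>))"
    unfolding Jeq by (subst integral_add[OF i1 i2]) (simp add: t1 t2)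
  then show "k x r = - ((1/2) *\<^sub>R integral {0..Y} (\<lambda>y. q y ** J y))"
    using k[OF x, of r] r by (simp add: algebra_simps)
qed

text \<open>Insert the kernel equation into the integral of k(x,r) G'(\<sigma> - r) with \<sigma> =
  t - x and integrate over r first. For fixed y the free term leaves G' on the window [2 m, 2 y]
  with m = max 0 (y - x), and the double integral leaves it on [\<rho> + 2 m, \<rho> + 2 y] for each
  \<rho>, with weight k(y,\<rho>). Hence only differences of G remain. The lower ends add up to the
  wave of G at y and time t - |x - y|, the upper ends to the one at time t - x - y.\<close>

lemma wave_map_Duhamel:
  fixes q k
  assumes q: "L1_loc (q :: real \<Rightarrow> complex ^ 'n ^ 'n)"
    and kc: "continuous_on UNIV (\<lambda>p. k (fst p) (snd p))"
    and k: "\<And>x r. 0 \<le> x \<Longrightarrow> 0 \<le> r \<Longrightarrow> k x r = - ((1/2) *\<^sub>R integral {r/2..r/2 + x} q)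
      - (1/2) *\<^sub>R integral {0..r} (\<lambda>\<rho>. integral {(r - \<rho>)/2..(r - \<rho>)/2 + x} (\<lambda>y. q y ** k y \<rho>))"
    and T: "T > 0"
    and G: "\<And>s. (G has_vector_derivative G' s) (at s)" and G'c: "continuous_on UNIV G'"
    and z: "\<And>s. s \<le> 0 \<Longrightarrow> G s = 0"
    and x: "0 \<le> x" and t: "t \<le> T"
  shows "wave_map k T G' x t = G' (t - x) -
    (1/2) *\<^sub>R integral {0..T} (\<lambda>y. q y *v (wave_map k T G y (t - \<bar>x - y\<bar>) - wave_map k T G y (t - x - y)))"
proof -
  \<comment> \<open>Large enough for the kernel equation, which needs T/2 + x, and for the final
    reduction of the y-integral to [0,T].\<close>
  define Y where "Y = T + x"
  have Y: "T / 2 + x \<le> Y" "0 < Y" "T \<le> Y" using T x by (auto simp: Y_def)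
  define \<sigma> where "\<sigma> = t - x"
  have \<sigma>: "\<sigma> \<le> T" using x t by (simp add: \<sigma>_def)
  have qY: "q absolutely_integrable_on {0..Y}" using q Y by (auto simp: L1_loc_def)
  note bb = bounded_bilinear_matrix_vector_mult[where 'n='n and 'm='n]
  define M where "M y r = integral {0..T} (\<lambda>\<rho>. if r - 2 * y \<le> \<rho> \<and> \<rho> \<le> r - 2 * max 0 (y - x) then k y \<rho> else 0)" for y r
  define w where "w y r = (if r/2 \<le> y \<and> y \<le> r/2 + x then mat 1 else (0 :: complex ^ 'n ^ 'n))" for y r
  have k': "k x r = - ((1/2) *\<^sub>R integral {0..Y} (\<lambda>y. q y ** (w y r + M y r)))"
    and qJi: "(\<lambda>y. q y ** (w y r + M y r)) integrable_on {0..Y}" if "r \<in> {0..T}" for r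
    using characteristic_kernel_eq[OF q kc k x that Y(1,2)] unfolding w_def M_def by blast+
  have Mc: "continuous_on UNIV (\<lambda>p. M (fst p) (snd p))"
    unfolding M_def by (rule continuous_on_integral_window[OF kc]) (auto intro!: continuous_intros)
  define H where "H y r = (w y r + M y r) *v G' (\<sigma> - r)" for y r
  \<comment> \<open>The condition r/2 \<le> y \<le> r/2 + x solved for r; the lower bound takes r
    \<ge> 0 into account.\<close>
  have Heq: "H y r = (if 2 * max 0 (y - x) \<le> r \<and> r \<le> 2 * y then G' (\<sigma> - r) else 0) + M y r *v G' (\<sigma> - r)"
    if "0 \<le> r" for y r
    using that by (auto simp: H_def w_def matrix_vector_mult_add_rdistrib field_simps max_def)
  have G'm[measurable]: "G' \<in> borel_measurable borel"
    by (rule borel_measurable_continuous_onI[OF G'c])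
  have MGc: "continuous_on UNIV (\<lambda>p. M (fst p) (snd p) *v G' (\<sigma> - snd p))"
    by (intro continuous_intros Mc continuous_on_compose2[OF G'c]) auto
  have MGm[measurable]: "(\<lambda>p. M (fst p) (snd p) *v G' (\<sigma> - snd p)) \<in> borel_measurable (borel \<Otimes>\<^sub>M borel)"
    using borel_measurable_continuous_onI[OF MGc] by (simp add: borel_prod)
  have Hm: "(\<lambda>p. H (fst p) (snd p)) \<in> borel_measurable borel"
  proof -
    have "H y r = (if r/2 \<le> y \<and> y \<le> r/2 + x then G' (\<sigma> - r) else 0) + M y r *v G' (\<sigma> - r)" for y r
      by (simp add: H_def w_def matrix_vector_mult_add_rdistrib)
    then show ?thesis
      unfolding borel_prod[symmetric] by simp
  qed
  obtain C1 where C1: "C1 \<ge> 0" "\<And>y r. y \<in> {0..Y} \<Longrightarrow> r \<in> {0..T} \<Longrightarrow> norm (M y r *v G' (\<sigma> - r)) \<le> C1"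
    using continuous_rectangle_bound[of "\<lambda>y r. M y r *v G' (\<sigma> - r)", OF MGc] by blast
  have G'2: "continuous_on UNIV (\<lambda>p. G' (\<sigma> - snd p))"
    by (intro continuous_on_compose2[OF G'c] continuous_intros) auto
  obtain C2 where C2: "C2 \<ge> 0" "\<And>y r. y \<in> {0::real..Y} \<Longrightarrow> r \<in> {0..T} \<Longrightarrow> norm (G' (\<sigma> - r)) \<le> C2"
    using continuous_rectangle_bound[of "\<lambda>y r. G' (\<sigma> - r)", OF G'2] by blast
  have Hb: "norm (H y r) \<le> C1 + C2" if "y \<in> {0..Y}" "r \<in> {0..T}" for y r
  proof -
    have "norm (H y r) \<le> norm (if 2 * max 0 (y - x) \<le> r \<and> r \<le> 2 * y then G' (\<sigma> - r) else 0) + norm (M y r *v G' (\<sigma> - r))"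
      using that by (simp only: Heq atLeastAtMost_iff norm_triangle_ineq)
    then show ?thesis using C1(2)[OF that] C2(2)[OF that] C2(1) by (auto split: if_splits)
  qed
  have "integral {0..T} (\<lambda>r. k x r *v G' (\<sigma> - r)) =
      integral {0..T} (\<lambda>r. (- 1/2) *\<^sub>R integral {0..Y} (\<lambda>y. q y *v H y r))"
  proof (rule integral_cong)
    fix r assume r: "r \<in> {0..T}"
    have "k x r *v G' (\<sigma> - r) = (- 1/2) *\<^sub>R (integral {0..Y} (\<lambda>y. q y ** (w y r + M y r)) *v G' (\<sigma> - r))"
      using k'[OF r] by (simp add: bounded_bilinear.minus_left[OF bb] bounded_bilinear.scaleR_left[OF bb])
    also have "\<dots> = (- 1/2) *\<^sub>R integral {0..Y} (\<lambda>y. q y *v H y r)"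
      by (simp add: integral_matrix_vector_mult[OF qJi[OF r]] H_def matrix_vector_mul_assoc)
    finally show "k x r *v G' (\<sigma> - r) = (- 1/2) *\<^sub>R integral {0..Y} (\<lambda>y. q y *v H y r)" .
  qed
  also have "\<dots> = (- 1/2) *\<^sub>R integral {0..Y} (\<lambda>y. q y *v integral {0..T} (H y))"
    using Fubini_bilinear(4)[OF bb qY Hm Hb, of 0 T] by simp
  also have "integral {0..Y} (\<lambda>y. q y *v integral {0..T} (H y)) =
     integral {0..Y} (\<lambda>y. q y *v (wave_map k T G y (t - \<bar>x - y\<bar>) - wave_map k T G y (t - x - y)))"
  proof (rule integral_cong)
    fix y assume y: "y \<in> {0..Y}"
    \<comment> \<open>With this choice x + 2 m = y + |x - y|, which is how the absolute value enters
      the formula.\<close>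
    define m where "m = max 0 (y - x)"
    have m: "0 \<le> m" "m \<le> y" "\<And>s. \<sigma> - s - 2 * m = t - \<bar>x - y\<bar> - y - s"
      using y x by (auto simp: m_def \<sigma>_def max_def)
    have Gc: "continuous_on UNIV G" using G by (intro continuous_on_vector_derivative) auto
    \<comment> \<open>The window r - 2 y \<le> \<rho> \<le> r - 2 m of \<open>M\<close>, solved for
      r, so that the r-integration can be done first.\<close>
    define kk where "kk \<rho> r = (if \<rho> + 2 * m \<le> r \<and> r \<le> \<rho> + 2 * y then G' (\<sigma> - r) else 0)" for \<rho> r
    have kkm: "(\<lambda>p. kk (fst p) (snd p)) \<in> borel_measurable borel"
      unfolding kk_def borel_prod[symmetric] by measurable
    have kkb: "norm (kk \<rho> r) \<le> C2" if "\<rho> \<in> {0..T}" "r \<in> {0..T}" for \<rho> r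
      using C2(2)[OF y that(2)] C2(1) by (auto simp: kk_def)
    have kyc: "continuous_on {0..T} (k y)"
      by (intro continuous_on_curried[OF kc] continuous_intros)
    have kyi: "k y absolutely_integrable_on {0..T}"
      by (rule absolutely_integrable_continuous_real[OF kyc])
    have "integral {0..T} (\<lambda>r. M y r *v G' (\<sigma> - r)) = integral {0..T} (\<lambda>r. integral {0..T} (\<lambda>\<rho>. k y \<rho> *v kk \<rho> r))"
    proof (rule integral_cong)
      fix r assume r: "r \<in> {0..T}"
      have "k y integrable_on ({r - 2 * y..r - 2 * m} \<inter> {0..T})"
        by (simp add: integrable_continuous_real[OF continuous_on_subset[OF kyc]])
      then have "(\<lambda>\<rho>. if \<rho> \<in> {r - 2 * y..r - 2 * m} then k y \<rho> else 0) integrable_on {0..T}"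
        by (simp only: integrable_restrict_Int)
      then have "M y r *v G' (\<sigma> - r) = integral {0..T} (\<lambda>\<rho>. (if \<rho> \<in> {r - 2 * y..r - 2 * m} then k y \<rho> else 0) *v G' (\<sigma> - r))"
        unfolding M_def m_def[symmetric] by (simp add: integral_matrix_vector_mult)
      also have "\<dots> = integral {0..T} (\<lambda>\<rho>. k y \<rho> *v kk \<rho> r)"
        by (rule integral_cong) (auto simp: kk_def)
      finally show "M y r *v G' (\<sigma> - r) = integral {0..T} (\<lambda>\<rho>. k y \<rho> *v kk \<rho> r)" .
    qed
    also have "\<dots> = integral {0..T} (\<lambda>\<rho>. k y \<rho> *v integral {0..T} (kk \<rho>))"
      by (rule Fubini_bilinear(4)[OF bb kyi kkm kkb])
    also have "\<dots> = integral {0..T} (\<lambda>\<rho>. k y \<rho> *v G (\<sigma> - (\<rho> + 2 * m)) - k y \<rho> *v G (\<sigma> - (\<rho> + 2 * y)))"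
      by (rule integral_cong)
        (use m \<sigma> in \<open>auto simp: kk_def[abs_def] integral_window_FTC[OF G z] matrix_vector_mult_diff_distrib\<close>)
    also have "\<dots> = integral {0..T} (\<lambda>\<rho>. k y \<rho> *v G (\<sigma> - (\<rho> + 2 * m))) - integral {0..T} (\<lambda>\<rho>. k y \<rho> *v G (\<sigma> - (\<rho> + 2 * y)))"
      by (intro integral_diff integrable_continuous_real continuous_intros kyc continuous_on_compose2[OF Gc]) auto
    finally have p2: "integral {0..T} (\<lambda>r. M y r *v G' (\<sigma> - r)) = \<dots>" .
    have "integral {0..T} (H y) = integral {0..T} (\<lambda>r. (if 2 * m \<le> r \<and> r \<le> 2 * y then G' (\<sigma> - r) else 0) + M y r *v G' (\<sigma> - r))"
      by (rule integral_cong) (auto simp: Heq m_def)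
    also have "\<dots> = integral {0..T} (\<lambda>r. if 2 * m \<le> r \<and> r \<le> 2 * y then G' (\<sigma> - r) else 0) + integral {0..T} (\<lambda>r. M y r *v G' (\<sigma> - r))"
    proof (rule integral_add)
      have "(\<lambda>r. G' (\<sigma> - r)) integrable_on ({2 * m..2 * y} \<inter> {0..T})"
        by (simp add: integrable_continuous_real[OF continuous_on_compose2[OF G'c]] continuous_intros)
      then have "(\<lambda>r. if r \<in> {2 * m..2 * y} then G' (\<sigma> - r) else 0) integrable_on {0..T}"
        by (simp only: integrable_restrict_Int)
      then show "(\<lambda>r. if 2 * m \<le> r \<and> r \<le> 2 * y then G' (\<sigma> - r) else 0) integrable_on {0..T}" by simp
      show "(\<lambda>r. M y r *v G' (\<sigma> - r)) integrable_on {0..T}"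
        by (intro integrable_continuous_real continuous_intros continuous_on_curried[OF Mc] continuous_on_compose2[OF G'c]) auto
    qed
    also have "\<dots> = wave_map k T G y (t - \<bar>x - y\<bar>) - wave_map k T G y (t - x - y)"
      unfolding p2 using m(1,2) m(3)[of 0] \<sigma> m(3)
      by (subst integral_window_FTC[OF G z])
        (simp_all add: wave_map_def \<sigma>_def diff_diff_eq algebra_simps)
    finally show "q y *v integral {0..T} (H y) = q y *v (wave_map k T G y (t - \<bar>x - y\<bar>) - wave_map k T G y (t - x - y))"
      by simp
  qed
  \<comment> \<open>For y > T both times are at most t \<le> T < y, and neither wave has reached
    y.\<close>
  also have "\<dots> = integral {0..Y} (\<lambda>y. if y \<in> {0..T} then q y *v (wave_map k T G y (t - \<bar>x - y\<bar>) - wave_map k T G y (t - x - y)) else 0)"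
    by (rule integral_cong) (use t x in \<open>auto simp: wave_map_eq_0[OF z]\<close>)
  also have "\<dots> = integral {0..T} (\<lambda>y. q y *v (wave_map k T G y (t - \<bar>x - y\<bar>) - wave_map k T G y (t - x - y)))"
    unfolding integral_restrict_Int using Y by (simp add: Int_absorb2)
  finally show ?thesis
    by (simp add: wave_map_def[of k T G'] \<sigma>_def)
qed

section \<open>The integrated wave equation\<close>

lemma Taylor_integral_remainder_2:
  fixes Q Q1 Q2 :: "real \<Rightarrow> 'a::banach"
  assumes "\<And>s. (Q has_vector_derivative Q1 s) (at s)" "\<And>s. (Q1 has_vector_derivative Q2 s) (at s)" "0 \<le> x"
  shows "integral {0..x} (\<lambda>z. (x - z) *\<^sub>R Q2 z) = Q x - Q 0 - x *\<^sub>R Q1 0"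
proof -
  have "((\<lambda>z. (x - z) *\<^sub>R Q1 z + Q z) has_vector_derivative (x - z) *\<^sub>R Q2 z) (at z within {0..x})" for z
    by (rule has_vector_derivative_at_within, rule has_vector_derivative_eq_rhs,
        rule has_vector_derivative_add[OF has_vector_derivative_scaleR[of "\<lambda>z. x - z" "-1"] assms(1)])
      (auto intro!: derivative_eq_intros assms simp: has_real_derivative_iff_has_vector_derivative[symmetric])
  then have "((\<lambda>z. (x - z) *\<^sub>R Q2 z) has_integral ((x - x) *\<^sub>R Q1 x + Q x) - ((x - 0) *\<^sub>R Q1 0 + Q 0)) {0..x}"
    by (intro fundamental_theorem_of_calculus assms) auto
  then show ?thesis by (simp add: integral_unique algebra_simps)
qed

text \<open>At 0 the even reflection of \<psi> has right slope \<open>\<psi>1 0\<close> and left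
  slope its negative; subtracting |z| times \<open>\<psi>1 0\<close> makes both slopes 0.\<close>

lemma has_vector_derivative_abs_corrected:
  fixes \<psi> \<psi>1 :: "real \<Rightarrow> 'a::real_normed_vector"
  assumes "\<And>s. (\<psi> has_vector_derivative \<psi>1 s) (at s)"
  shows "((\<lambda>z. \<psi> \<bar>z\<bar> - \<bar>z\<bar> *\<^sub>R \<psi>1 0) has_vector_derivative sgn z *\<^sub>R (\<psi>1 \<bar>z\<bar> - \<psi>1 0)) (at z)"
proof -
  consider "z > 0" | "z < 0" | "z = 0" by linarith
  then show ?thesis
  proof cases
    case 1
    have "((\<lambda>z. \<psi> z - z *\<^sub>R \<psi>1 0) has_vector_derivative \<psi>1 z - \<psi>1 0) (at z)"
      by (auto intro!: derivative_eq_intros assms)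
    then have "((\<lambda>z. \<psi> \<bar>z\<bar> - \<bar>z\<bar> *\<^sub>R \<psi>1 0) has_vector_derivative \<psi>1 z - \<psi>1 0) (at z)"
      by (rule has_vector_derivative_transform_within_open[of _ _ _ "{0<..}"]) (use 1 in auto)
    then show ?thesis using 1 by simp
  next
    case 2
    have "((\<lambda>z. \<psi> (- 1 * z + 0) - (- z) *\<^sub>R \<psi>1 0) has_vector_derivative - 1 *\<^sub>R \<psi>1 (- 1 * z + 0) - (- 1) *\<^sub>R \<psi>1 0) (at z)"
      by (intro has_vector_derivative_diff has_vector_derivative_compose_affine assms)
        (auto intro!: derivative_eq_intros)
    then have "((\<lambda>z. \<psi> \<bar>z\<bar> - \<bar>z\<bar> *\<^sub>R \<psi>1 0) has_vector_derivative - 1 *\<^sub>R \<psi>1 (- 1 * z + 0) - (- 1) *\<^sub>R \<psi>1 0) (at z)"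
      by (rule has_vector_derivative_transform_within_open[of _ _ _ "{..<0}"]) (use 2 in auto)
    then show ?thesis using 2 by simp
  next
    case 3
    have alt: "\<exists>d>0. \<forall>y. norm (y - 0) < d \<longrightarrow> norm (\<psi> y - \<psi> 0 - (y - 0) *\<^sub>R \<psi>1 0) \<le> e * norm (y - 0)" if "e > 0" for e
      using assms[of 0] that unfolding has_vector_derivative_def has_derivative_at_alt by blast
    have "((\<lambda>z. \<psi> \<bar>z\<bar> - \<bar>z\<bar> *\<^sub>R \<psi>1 0) has_vector_derivative 0) (at 0)"
      unfolding has_vector_derivative_def has_derivative_at_alt
    proof (intro conjI allI impI)
      fix e :: real assume "e > 0"
      then obtain d where d: "d > 0" "\<And>y. norm (y - 0) < d \<Longrightarrow> norm (\<psi> y - \<psi> 0 - (y - 0) *\<^sub>R \<psi>1 0) \<le> e * norm (y - 0)"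
        using alt by blast
      have "norm (\<psi> \<bar>y\<bar> - \<bar>y\<bar> *\<^sub>R \<psi>1 0 - (\<psi> \<bar>0\<bar> - \<bar>0\<bar> *\<^sub>R \<psi>1 0) - (y - 0) *\<^sub>R 0) \<le> e * norm (y - 0)"
        if "norm (y - 0) < d" for y
        using d(2)[of "\<bar>y\<bar>"] that by (simp add: algebra_simps)
      with d show "\<exists>d>0. \<forall>y. norm (y - 0) < d \<longrightarrow>
          norm (\<psi> \<bar>y\<bar> - \<bar>y\<bar> *\<^sub>R \<psi>1 0 - (\<psi> \<bar>0\<bar> - \<bar>0\<bar> *\<^sub>R \<psi>1 0) - (y - 0) *\<^sub>R 0) \<le> e * norm (y - 0)"
        by blast
    qed (simp add: bounded_linear_zero)
    then show ?thesis using 3 by simp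
  qed
qed

text \<open>The odd reflection of \<psi> - \<psi>(0) passes through 0 with the slope
  \<open>\<psi>1 0\<close> on both sides. Applied to the derivative of \<psi>, it differentiates the
  result of \<open>has_vector_derivative_abs_corrected\<close> once more.\<close>

lemma has_vector_derivative_odd_extension:
  fixes \<psi> \<psi>1 :: "real \<Rightarrow> 'a::real_normed_vector"
  assumes "\<And>s. (\<psi> has_vector_derivative \<psi>1 s) (at s)"
  shows "((\<lambda>z. sgn z *\<^sub>R (\<psi> \<bar>z\<bar> - \<psi> 0)) has_vector_derivative \<psi>1 \<bar>z\<bar>) (at z)"
proof -
  consider "z > 0" | "z < 0" | "z = 0" by linarith
  then show ?thesis
  proof cases
    case 1
    have "((\<lambda>z. \<psi> z - \<psi> 0) has_vector_derivative \<psi>1 z) (at z)"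
      by (auto intro!: derivative_eq_intros assms)
    then have "((\<lambda>z. sgn z *\<^sub>R (\<psi> \<bar>z\<bar> - \<psi> 0)) has_vector_derivative \<psi>1 z) (at z)"
      by (rule has_vector_derivative_transform_within_open[of _ _ _ "{0<..}"]) (use 1 in auto)
    then show ?thesis using 1 by simp
  next
    case 2
    have "((\<lambda>z. \<psi> 0 - \<psi> (- 1 * z + 0)) has_vector_derivative 0 - - 1 *\<^sub>R \<psi>1 (- 1 * z + 0)) (at z)"
      by (intro has_vector_derivative_diff has_vector_derivative_compose_affine assms has_vector_derivative_const)
    then have "((\<lambda>z. sgn z *\<^sub>R (\<psi> \<bar>z\<bar> - \<psi> 0)) has_vector_derivative 0 - - 1 *\<^sub>R \<psi>1 (- 1 * z + 0)) (at z)"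
      by (rule has_vector_derivative_transform_within_open[of _ _ _ "{..<0}"]) (use 2 in auto)
    then show ?thesis using 2 by simp
  next
    case 3
    have alt: "\<exists>d>0. \<forall>y. norm (y - 0) < d \<longrightarrow> norm (\<psi> y - \<psi> 0 - (y - 0) *\<^sub>R \<psi>1 0) \<le> e * norm (y - 0)" if "e > 0" for e
      using assms[of 0] that unfolding has_vector_derivative_def has_derivative_at_alt by blast
    have "((\<lambda>z. sgn z *\<^sub>R (\<psi> \<bar>z\<bar> - \<psi> 0)) has_vector_derivative \<psi>1 0) (at 0)"
      unfolding has_vector_derivative_def has_derivative_at_alt
    proof (intro conjI allI impI)
      fix e :: real assume "e > 0"
      then obtain d where d: "d > 0" "\<And>y. norm (y - 0) < d \<Longrightarrow> norm (\<psi> y - \<psi> 0 - (y - 0) *\<^sub>R \<psi>1 0) \<le> e * norm (y - 0)"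
        using alt by blast
      have "norm (sgn y *\<^sub>R (\<psi> \<bar>y\<bar> - \<psi> 0) - sgn 0 *\<^sub>R (\<psi> \<bar>0\<bar> - \<psi> 0) - (y - 0) *\<^sub>R \<psi>1 0) \<le> e * norm (y - 0)"
        if "norm (y - 0) < d" for y :: real
      proof -
        have "sgn y *\<^sub>R (\<psi> \<bar>y\<bar> - \<psi> 0) - sgn 0 *\<^sub>R (\<psi> \<bar>0\<bar> - \<psi> 0) - (y - 0) *\<^sub>R \<psi>1 0 = sgn y *\<^sub>R (\<psi> \<bar>y\<bar> - \<psi> 0 - (\<bar>y\<bar> - 0) *\<^sub>R \<psi>1 0)"
          by (cases "y \<ge> 0") (auto simp: sgn_if algebra_simps)
        also have "norm \<dots> \<le> norm (\<psi> \<bar>y\<bar> - \<psi> 0 - (\<bar>y\<bar> - 0) *\<^sub>R \<psi>1 0)"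
          by (auto simp: sgn_if)
        also have "\<dots> \<le> e * norm (y - 0)"
          using d(2)[of "\<bar>y\<bar>"] that by simp
        finally show ?thesis .
      qed
      with d show "\<exists>d>0. \<forall>y. norm (y - 0) < d \<longrightarrow>
          norm (sgn y *\<^sub>R (\<psi> \<bar>y\<bar> - \<psi> 0) - sgn 0 *\<^sub>R (\<psi> \<bar>0\<bar> - \<psi> 0) - (y - 0) *\<^sub>R \<psi>1 0) \<le> e * norm (y - 0)"
        by blast
    qed (rule bounded_linear_scaleR_left)
    then show ?thesis using 3 by simp
  qed
qed

text \<open>
  The last term is the contribution of the jump of the derivative of \<open>\<psi> \<bar>z - y\<bar>\<close> at \<open>z = y\<close>; it is
  what produces the potential term of the wave equation.
\<close>

lemma integral_reflected_kernel:
  fixes \<psi> \<psi>1 \<psi>2 :: "real \<Rightarrow> 'a::banach"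
  assumes 1: "\<And>s. (\<psi> has_vector_derivative \<psi>1 s) (at s)" and 2: "\<And>s. (\<psi>1 has_vector_derivative \<psi>2 s) (at s)"
    and xy: "0 \<le> x" "0 \<le> y"
  shows "integral {0..x} (\<lambda>z. (x - z) *\<^sub>R (\<psi>2 \<bar>z - y\<bar> - \<psi>2 (z + y))) =
    \<psi> \<bar>x - y\<bar> - \<psi> (x + y) + (2 * x) *\<^sub>R \<psi>1 y - (2 * max 0 (x - y)) *\<^sub>R \<psi>1 0"
proof -
  \<comment> \<open>A second antiderivative of \<psi>2(|z|) without a kink, so Taylor's formula
    applies across z = y.\<close>
  define e where "e z = \<psi> \<bar>z\<bar> - \<bar>z\<bar> *\<^sub>R \<psi>1 0" for z
  define e1 where "e1 z = sgn z *\<^sub>R (\<psi>1 \<bar>z\<bar> - \<psi>1 0)" for z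
  have d1: "(e has_vector_derivative e1 z) (at z)" for z
    unfolding e_def[abs_def] e1_def by (rule has_vector_derivative_abs_corrected[OF 1])
  have d2: "(e1 has_vector_derivative \<psi>2 \<bar>z\<bar>) (at z)" for z
    unfolding e1_def[abs_def] by (rule has_vector_derivative_odd_extension[OF 2])
  have sh: "((\<lambda>z. h (z + c)) has_vector_derivative h' (z + c)) (at z)"
    if "\<And>z. (h has_vector_derivative h' z) (at z)" for h h' :: "real \<Rightarrow> 'a" and c z
    using has_vector_derivative_compose_affine[of h "h' (z + c)" 1 z c] that[of "z + c"] by simp
  have "integral {0..x} (\<lambda>z. (x - z) *\<^sub>R (\<psi>2 \<bar>z + - y\<bar> - \<psi>2 (z + y))) =
     (e (x + - y) - \<psi> (x + y)) - (e (0 + - y) - \<psi> (0 + y)) - x *\<^sub>R (e1 (0 + - y) - \<psi>1 (0 + y))"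
    by (rule Taylor_integral_remainder_2[of "\<lambda>z. e (z + - y) - \<psi> (z + y)" "\<lambda>z. e1 (z + - y) - \<psi>1 (z + y)"])
      (intro has_vector_derivative_diff sh[OF d1] sh[OF 1] sh[OF 2] sh[where h=e1 and h'="\<lambda>z. \<psi>2 \<bar>z\<bar>", OF d2] xy)+
  also have "e1 (0 + - y) = - (\<psi>1 y - \<psi>1 0)"
    using xy by (auto simp: e1_def sgn_if)
  also have "e (0 + - y) = \<psi> y - y *\<^sub>R \<psi>1 0"
    using xy by (simp add: e_def)
  also have "e (x + - y) = \<psi> \<bar>x - y\<bar> - \<bar>x - y\<bar> *\<^sub>R \<psi>1 0"
    by (simp add: e_def)
  finally have eq: "integral {0..x} (\<lambda>z. (x - z) *\<^sub>R (\<psi>2 \<bar>z + - y\<bar> - \<psi>2 (z + y))) =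
    \<psi> \<bar>x - y\<bar> - \<bar>x - y\<bar> *\<^sub>R \<psi>1 0 - \<psi> (x + y) - (\<psi> y - y *\<^sub>R \<psi>1 0 - \<psi> (0 + y)) -
      x *\<^sub>R (- (\<psi>1 y - \<psi>1 0) - \<psi>1 (0 + y))" .
  \<comment> \<open>The multiples of \<open>\<psi>1 0\<close> have the coefficients -|x - y|, y and
    -x; in this form they add up to -2 max 0 (x - y).\<close>
  have abs: "\<bar>x - y\<bar> = 2 * max 0 (x - y) + y - x" by (auto simp: max_def)
  have alg: "p - (m + y - x) *\<^sub>R b - r - (c - y *\<^sub>R b - c) - x *\<^sub>R (- (a - b) - a) =
      p - r + (x + x) *\<^sub>R a - m *\<^sub>R b" for p r a b c :: 'a and m
    by (simp add: scaleR_add_left scaleR_diff_left scaleR_diff_right) (simp only: mult_2 scaleR_add_left)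
  have "(\<lambda>z. (x - z) *\<^sub>R (\<psi>2 \<bar>z - y\<bar> - \<psi>2 (z + y))) = (\<lambda>z. (x - z) *\<^sub>R (\<psi>2 \<bar>z + - y\<bar> - \<psi>2 (z + y)))"
    by simp
  then have "integral {0..x} (\<lambda>z. (x - z) *\<^sub>R (\<psi>2 \<bar>z - y\<bar> - \<psi>2 (z + y))) =
    \<psi> \<bar>x - y\<bar> - (2 * max 0 (x - y) + y - x) *\<^sub>R \<psi>1 0 - \<psi> (x + y) - (\<psi> y - y *\<^sub>R \<psi>1 0 - \<psi> y) -
      x *\<^sub>R (- (\<psi>1 y - \<psi>1 0) - \<psi>1 y)"
    using eq by (simp only: abs[symmetric] add_0)
  also have "\<dots> = \<psi> \<bar>x - y\<bar> - \<psi> (x + y) + (x + x) *\<^sub>R \<psi>1 y - (2 * max 0 (x - y)) *\<^sub>R \<psi>1 0"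
    by (rule alg)
  finally show ?thesis by (simp only: mult_2[of x])
qed

text \<open>Instance of \<open>Fubini_bilinear\<close> in which the kernel is constant in its second
  variable and that variable ranges over the single point 0.\<close>

lemma absolutely_integrable_matrix_vector_mult_continuous:
  fixes q :: "real \<Rightarrow> complex ^ 'n ^ 'm"
  assumes q: "q absolutely_integrable_on {a..b}" and g: "continuous_on UNIV g"
  shows "(\<lambda>y. q y *v g y) absolutely_integrable_on {a..b}"
proof -
  have gc: "continuous_on UNIV (\<lambda>p::real\<times>real. g (fst p))"
    by (intro continuous_on_compose2[OF g] continuous_intros) auto
  have gm: "(\<lambda>p::real\<times>real. g (fst p)) \<in> borel_measurable borel"
    by (rule borel_measurable_continuous_onI[OF gc])
  obtain C where "C \<ge> 0" "\<And>y z::real. y \<in> {a..b} \<Longrightarrow> z \<in> {0..0} \<Longrightarrow> norm (g y) \<le> C"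
    using continuous_rectangle_bound[of "\<lambda>y z. g y", OF gc, of a b 0 0] by blast
  then show ?thesis
    using Fubini_bilinear(1)[OF bounded_bilinear_matrix_vector_mult q gm, of 0 0 C 0] by auto
qed

text \<open>Duhamel's formula for \<open>U 3\<close>, integrated with the weight x - z, produces the
  integral \<open>I\<close>, which also occurs in Duhamel's formula for \<open>U 1\<close>;
  eliminating it gives the claim. The coefficient of x is the boundary value of u_x.\<close>

lemma wave_map_integral_equation:
  fixes q k and G :: "nat \<Rightarrow> real \<Rightarrow> complex ^ 'n"
  assumes q: "L1_loc (q :: real \<Rightarrow> complex ^ 'n ^ 'n)"
    and kc: "continuous_on UNIV (\<lambda>p. k (fst p) (snd p))"
    and k: "\<And>x r. 0 \<le> x \<Longrightarrow> 0 \<le> r \<Longrightarrow> k x r = - ((1/2) *\<^sub>R integral {r/2..r/2 + x} q)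
      - (1/2) *\<^sub>R integral {0..r} (\<lambda>\<rho>. integral {(r - \<rho>)/2..(r - \<rho>)/2 + x} (\<lambda>y. q y ** k y \<rho>))"
    and T: "T > 0"
    and z: "\<And>j s. j \<le> 3 \<Longrightarrow> s \<le> 0 \<Longrightarrow> G j s = 0"
    and G: "\<And>j s. j < 3 \<Longrightarrow> (G j has_vector_derivative G (Suc j) s) (at s)"
    and Gc: "\<And>j. j \<le> 3 \<Longrightarrow> continuous_on UNIV (G j)"
    and t: "t \<le> T"
  defines "U \<equiv> \<lambda>j x s. wave_map k T (G j) x s"
  defines "B \<equiv> integral {0..T} (\<lambda>y. q y *v U 1 y (t - y))"
  assumes x: "0 \<le> x"
  shows "U 1 x t = G 1 t + x *\<^sub>R (- G 2 t - B) +
    integral {0..x} (\<lambda>y. (x - y) *\<^sub>R (U 3 y t + q y *v U 1 y t))"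
proof -
  have qi: "q absolutely_integrable_on {0..R}" if "R > 0" for R using q that by (simp add: L1_loc_def)
  note bb = bounded_bilinear_matrix_vector_mult[where 'n='n and 'm='n]
  have Uc: "continuous_on UNIV (\<lambda>p. U j (fst p) (snd p))" if "j \<le> 3" for j
    unfolding U_def by (rule continuous_on_wave_map[OF kc Gc[OF that]])
  have Uz: "U j y s = 0" if "j \<le> 3" "s \<le> y" for j y s
    unfolding U_def by (rule wave_map_eq_0[OF z]) (use that in auto)
  have UD: "U (Suc j) y t = G (Suc j) (t - y) -
      (1/2) *\<^sub>R integral {0..T} (\<lambda>r. q r *v (U j r (t - \<bar>y - r\<bar>) - U j r (t - y - r)))" if "j < 3" "0 \<le> y" for j y
    unfolding U_def using that by (intro wave_map_Duhamel[OF q kc k T G Gc z]) (auto simp: t)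
  have dU: "((\<lambda>s. U j y (t - s)) has_vector_derivative - U (Suc j) y (t - s)) (at s)" if "j < 3" for j y s
    using has_vector_derivative_compose_affine[of "U j y" "U (Suc j) y (t - s)" "- 1" s t] that
      has_vector_derivative_wave_map[OF kc G[OF that] Gc[of "Suc j"], of T y "t - s"] by (simp add: U_def)
  have dG: "((\<lambda>s. G j (t - s)) has_vector_derivative - G (Suc j) (t - s)) (at s)" if "j < 3" for j s
    using has_vector_derivative_compose_affine[of "G j" "G (Suc j) (t - s)" "- 1" s t] G[OF that] by simp
  define K where "K j y z = U j y (t - \<bar>z - y\<bar>) - U j y (t - z - y)" for j y z
  have Kc: "continuous_on S (\<lambda>p. K j (a p) (b p))" if "continuous_on S a" "continuous_on S b" "j \<le> 3"
    for S :: "'z::topological_space set" and a b j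
    unfolding K_def by (intro continuous_intros continuous_on_curried[OF Uc] that)
  define N where "N y = integral {0..x} (\<lambda>z. (x - z) *\<^sub>R K 2 y z)" for y
  \<comment> \<open>Here \<psi>(s) is \<open>U 0 y (t - s)\<close>. Differentiation in s changes the
    sign each time, so the kink term appears with a positive sign.\<close>
  have N: "N y = K 0 y x - (2 * x) *\<^sub>R U 1 y (t - y) + (2 * max 0 (x - y)) *\<^sub>R U 1 y t" if "y \<in> {0..T}" for y
  proof -
    have "integral {0..x} (\<lambda>z. (x - z) *\<^sub>R (U 2 y (t - \<bar>z - y\<bar>) - U 2 y (t - (z + y)))) =
      U 0 y (t - \<bar>x - y\<bar>) - U 0 y (t - (x + y)) + (2 * x) *\<^sub>R (- U 1 y (t - y)) - (2 * max 0 (x - y)) *\<^sub>R (- U 1 y (t - 0))"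
    proof (rule integral_reflected_kernel[where \<psi>="\<lambda>s. U 0 y (t - s)" and ?\<psi>1.0="\<lambda>s. - U 1 y (t - s)" and ?\<psi>2.0="\<lambda>s. U 2 y (t - s)"])
      show "((\<lambda>s. U 0 y (t - s)) has_vector_derivative - U 1 y (t - s)) (at s)" for s
        using dU[of 0 y s] by simp
      show "((\<lambda>s. - U 1 y (t - s)) has_vector_derivative U 2 y (t - s)) (at s)" for s
        using has_vector_derivative_minus[OF dU[of 1 y s]] by (simp add: numeral_2_eq_2)
    qed (use that x in auto)
    then show ?thesis by (simp add: N_def K_def diff_diff_eq)
  qed
  have Ii: "(\<lambda>y. q y *v g y) absolutely_integrable_on {0..R}" if "continuous_on UNIV g" "R > 0" for g R
    by (rule absolutely_integrable_matrix_vector_mult_continuous[OF qi that(1)]) fact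
  note Ii' = set_lebesgue_integral_eq_integral(1)[OF Ii]
  have g1: "continuous_on UNIV (\<lambda>y. K 0 y x)" by (intro Kc continuous_intros) auto
  have g2: "continuous_on UNIV (\<lambda>y. U 1 y (t - y))" by (intro continuous_on_curried[OF Uc] continuous_intros) auto
  have g3: "continuous_on UNIV (\<lambda>y. max 0 (x - y) *\<^sub>R U 1 y t)" by (intro continuous_intros continuous_on_curried[OF Uc]) auto
  have g4: "continuous_on UNIV (\<lambda>y. U 1 y t)" by (intro continuous_intros continuous_on_curried[OF Uc]) auto
  have g5: "continuous_on UNIV (\<lambda>y. U 3 y t)" by (intro continuous_intros continuous_on_curried[OF Uc]) auto
  define I where "I = integral {0..T} (\<lambda>y. q y *v K 0 y x)"
  define P where "P = integral {0..T} (\<lambda>y. q y *v (max 0 (x - y) *\<^sub>R U 1 y t))"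
  have kkc: "continuous_on UNIV (\<lambda>p. (x - snd p) *\<^sub>R K 2 (fst p) (snd p))"
    by (intro continuous_intros Kc) auto
  obtain C where C: "C \<ge> 0" "\<And>y z. y \<in> {0..T} \<Longrightarrow> z \<in> {0..x} \<Longrightarrow> norm ((x - z) *\<^sub>R K 2 y z) \<le> C"
    using continuous_rectangle_bound[of "\<lambda>y z. (x - z) *\<^sub>R K 2 y z", OF kkc, of 0 T 0 x] by blast
  note F = Fubini_bilinear[OF bb qi[OF T] borel_measurable_continuous_onI[OF kkc] C(2)]
  \<comment> \<open>The weight is moved under the r-integral so that it becomes part of the bounded
    kernel in the next exchange of integrals.\<close>
  have U3: "(x - y) *\<^sub>R U 3 y t = (x - y) *\<^sub>R G 3 (t - y) -
      (1/2) *\<^sub>R integral {0..T} (\<lambda>r. q r *v ((x - y) *\<^sub>R K 2 r y))" if "y \<in> {0..x}" for y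
  proof -
    have "U 3 y t = G 3 (t - y) - (1/2) *\<^sub>R integral {0..T} (\<lambda>r. q r *v K 2 r y)"
      using UD[of 2 y] that by (simp add: K_def numeral_3_eq_3 numeral_2_eq_2)
    moreover have "(x - y) *\<^sub>R integral {0..T} (\<lambda>r. q r *v K 2 r y) = integral {0..T} (\<lambda>r. q r *v ((x - y) *\<^sub>R K 2 r y))"
      by (simp add: bounded_bilinear.scaleR_right[OF bb] flip: integral_cmul)
    ultimately show ?thesis by (simp only: scaleR_diff_right scaleR_left_commute[of "x - y" "1/2"])
  qed
  have "integral {0..x} (\<lambda>y. (x - y) *\<^sub>R U 3 y t) = integral {0..x} (\<lambda>y. (x - y) *\<^sub>R G 3 (t - y) -
      (1/2) *\<^sub>R integral {0..T} (\<lambda>r. q r *v ((x - y) *\<^sub>R K 2 r y)))"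
    by (rule integral_cong) (rule U3)
  also have "\<dots> = integral {0..x} (\<lambda>y. (x - y) *\<^sub>R G 3 (t - y)) -
      (1/2) *\<^sub>R integral {0..x} (\<lambda>y. integral {0..T} (\<lambda>r. q r *v ((x - y) *\<^sub>R K 2 r y)))"
  proof (subst integral_diff)
    show "(\<lambda>y. (x - y) *\<^sub>R G 3 (t - y)) integrable_on {0..x}"
      by (intro integrable_continuous_real continuous_intros continuous_on_compose2[OF Gc]) auto
    show "(\<lambda>y. (1/2) *\<^sub>R integral {0..T} (\<lambda>r. q r *v ((x - y) *\<^sub>R K 2 r y))) integrable_on {0..x}"
      by (intro integrable_cmul set_lebesgue_integral_eq_integral(1)[OF F(2)]) auto
  qed simp
  also have "integral {0..x} (\<lambda>y. integral {0..T} (\<lambda>r. q r *v ((x - y) *\<^sub>R K 2 r y))) = integral {0..T} (\<lambda>r. q r *v N r)"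
    unfolding N_def by (rule F(4))
  also have "\<dots> = integral {0..T} (\<lambda>y. q y *v K 0 y x - (2 * x) *\<^sub>R (q y *v U 1 y (t - y)) + 2 *\<^sub>R (q y *v (max 0 (x - y) *\<^sub>R U 1 y t)))"
    by (rule integral_cong)
      (simp add: N bounded_bilinear.scaleR_right[OF bb] bounded_bilinear.add_right[OF bb] bounded_bilinear.diff_right[OF bb])
  also have "\<dots> = I - (2 * x) *\<^sub>R B + 2 *\<^sub>R P"
    unfolding I_def B_def P_def
    by (simp only: integral_add integral_diff integral_cmul integrable_diff integrable_cmul Ii'[OF g1 T] Ii'[OF g2 T] Ii'[OF g3 T])
  also have "integral {0..x} (\<lambda>y. (x - y) *\<^sub>R G 3 (t - y)) = G 1 (t - x) - G 1 (t - 0) - x *\<^sub>R (- G 2 (t - 0))"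
  proof (rule Taylor_integral_remainder_2[OF _ _ x])
    show "((\<lambda>s. G 1 (t - s)) has_vector_derivative - G 2 (t - s)) (at s)" for s
      using dG[of 1 s] by (simp add: numeral_2_eq_2)
    show "((\<lambda>s. - G 2 (t - s)) has_vector_derivative G 3 (t - s)) (at s)" for s
      using has_vector_derivative_minus[OF dG[of 2 s]] by (simp add: numeral_2_eq_2 numeral_3_eq_3)
  qed
  finally have A: "integral {0..x} (\<lambda>y. (x - y) *\<^sub>R U 3 y t) =
      G 1 (t - x) - G 1 t + x *\<^sub>R G 2 t - (1/2) *\<^sub>R I + x *\<^sub>R B - P"
    by (simp add: algebra_simps scaleR_add_right scaleR_diff_right)
  \<comment> \<open>The same \<open>I\<close> as in \<open>A\<close>; subtracting the two removes
    both \<open>I\<close> and G 1 (t - x).\<close>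
  have u: "U 1 x t = G 1 (t - x) - (1/2) *\<^sub>R I"
    using UD[of 0 x] x by (simp add: I_def K_def)
  \<comment> \<open>\<open>P\<close> runs over [0,T], but the claim needs [0,x]. On [0, max T x] the
    two truncated integrands coincide: beyond T the wave \<open>U 1 y t\<close> vanishes, beyond x
    the factor max 0 (x - y) does.\<close>
  define h where "h y = q y *v (max 0 (x - y) *\<^sub>R U 1 y t)" for y
  have "P = integral {0..max T x} (\<lambda>y. if y \<in> {0..T} then h y else 0)"
    unfolding integral_restrict_Int P_def h_def by (simp add: Int_absorb2)
  also have "\<dots> = integral {0..max T x} (\<lambda>y. if y \<in> {0..x} then (x - y) *\<^sub>R (q y *v U 1 y t) else 0)"
    by (rule integral_cong) (use t in \<open>auto simp: h_def Uz bounded_bilinear.scaleR_right[OF bb]\<close>)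
  also have "\<dots> = integral {0..x} (\<lambda>y. (x - y) *\<^sub>R (q y *v U 1 y t))"
    unfolding integral_restrict_Int by (simp add: Int_absorb2)
  finally have P: "P = \<dots>" .
  have "integral {0..x} (\<lambda>y. (x - y) *\<^sub>R (U 3 y t + q y *v U 1 y t)) =
     integral {0..x} (\<lambda>y. (x - y) *\<^sub>R U 3 y t) + integral {0..x} (\<lambda>y. (x - y) *\<^sub>R (q y *v U 1 y t))"
  proof (simp only: scaleR_add_right, rule integral_add)
    show "(\<lambda>y. (x - y) *\<^sub>R U 3 y t) integrable_on {0..x}"
      by (intro integrable_continuous_real continuous_intros continuous_on_subset[OF g5]) auto
    show "(\<lambda>y. (x - y) *\<^sub>R (q y *v U 1 y t)) integrable_on {0..x}"
    proof (cases "x = 0")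
      case False
      have "continuous_on UNIV (\<lambda>y. (x - y) *\<^sub>R U 1 y t)" by (intro continuous_intros g4)
      from Ii'[OF this, of x] show ?thesis
        using False x by (simp add: bounded_bilinear.scaleR_right[OF bb])
    next
      case True
      then show ?thesis using integrable_on_refl[of _ "0 :: real"] by simp
    qed
  qed
  then show ?thesis
    unfolding A P[symmetric] u by (simp add: scaleR_diff_right)
qed

section \<open>Transfer to L2 and verification of the system\<close>

lemma L2_AE_cong:
  fixes y z :: "real \<Rightarrow> complex ^ 'n"
  assumes "y \<in> L2" and ae: "AE x in lebesgue_on {0..}. y x = z x"
  shows "z \<in> L2"
proof -
  have ym: "y \<in> borel_measurable (lebesgue_on {0..})" using assms by (simp add: L2_def)
  have "AE x in lebesgue. x \<in> {0..} \<longrightarrow> y x = z x"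
    using ae by (subst (asm) AE_restrict_space_iff) auto
  then have "AE x in lebesgue. indicator {0..} x *\<^sub>R y x = indicator {0..} x *\<^sub>R z x"
    by eventually_elim (auto simp: indicator_def)
  moreover have "(\<lambda>x. indicator {0..} x *\<^sub>R y x) \<in> borel_measurable lebesgue"
    using ym by (simp add: borel_measurable_restrict_space_iff)
  \<comment> \<open>By completeness of Lebesgue measure, changes on a null set, such as unspecified
    values of a second derivative, preserve measurability.\<close>
  ultimately have "(\<lambda>x. indicator {0..} x *\<^sub>R z x) \<in> borel_measurable lebesgue"
    by (rule borel_measurable_AE[rotated])
  then have zm: "z \<in> borel_measurable (lebesgue_on {0..})"
    by (simp add: borel_measurable_restrict_space_iff)
  have nm: "(\<lambda>x. (norm (w x))\<^sup>2) \<in> borel_measurable (lebesgue_on {0..})"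
    if "w \<in> borel_measurable (lebesgue_on {0..})" for w :: "real \<Rightarrow> complex ^ 'n"
    using that by measurable
  have "AE x in lebesgue_on {0..}. (norm (y x))\<^sup>2 = (norm (z x))\<^sup>2"
    using ae by eventually_elim simp
  then have "integrable (lebesgue_on {0..}) (\<lambda>x. (norm (y x))\<^sup>2) \<longleftrightarrow> integrable (lebesgue_on {0..}) (\<lambda>x. (norm (z x))\<^sup>2)"
    by (intro integrable_cong_AE nm ym zm)
  then show ?thesis using assms zm by (simp add: L2_def)
qed

lemma has_L2_derivative_cong:
  assumes U: "has_L2_derivative U D t S" and t: "t \<in> S"
    and eq: "\<And>s x. s \<in> S \<Longrightarrow> x \<ge> 0 \<Longrightarrow> U s x = V s x"
  shows "has_L2_derivative V D t S"
proof -
  have "L2_norm (\<lambda>x. (1 / (s - t)) *\<^sub>R (U s x - U t x) - D x) = L2_norm (\<lambda>x. (1 / (s - t)) *\<^sub>R (V s x - V t x) - D x)"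
    if "s \<in> S" for s
    by (rule L2_norm_cong) (simp add: eq that t)
  then have "\<forall>\<^sub>F s in at t within S. L2_norm (\<lambda>x. (1 / (s - t)) *\<^sub>R (U s x - U t x) - D x) =
      L2_norm (\<lambda>x. (1 / (s - t)) *\<^sub>R (V s x - V t x) - D x)"
    by (auto simp: eventually_at intro!: exI[of _ 1])
  from tendsto_cong[OF this] U show ?thesis by (simp add: has_L2_derivative_def)
qed

theorem theorem2:
  fixes q :: "real \<Rightarrow> complex ^ 'n ^ 'n"
    and v :: "real \<Rightarrow> real \<Rightarrow> complex ^ 'n ^ 'n"
    and f :: "real \<Rightarrow> complex ^ 'n"
    and T :: real
  assumes "T > 0"
    and "L1_loc q"
    and "AE x in lebesgue_on {0..}. hermitian (q x)"
    and "L0_positive_definite q"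
    and "smooth_on_Icc T f"
    and "closure {t \<in> {0..T}. f t \<noteq> 0} \<subseteq> {0<..T}"
    and "goursat_solution q v"
  shows "solves_system q T f (wave (kernel_w v) f)"
proof -
  note T = \<open>T > 0\<close> and q = \<open>L1_loc q\<close>
  obtain G :: "nat \<Rightarrow> real \<Rightarrow> complex ^ 'n" where
    Gf: "\<And>s. s \<le> T \<Longrightarrow> G 1 s = extend0 f s"
    and Gz: "\<And>j s. j \<le> 3 \<Longrightarrow> s \<le> 0 \<Longrightarrow> G j s = 0"
    and G: "\<And>j s. j < 3 \<Longrightarrow> (G j has_vector_derivative G (Suc j) s) (at s)"
    and Gc: "\<And>j. j \<le> 3 \<Longrightarrow> continuous_on UNIV (G j)"
    by (rule smooth_control_extension[OF assms(1,5,6)]) blast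
  define k where "k x r = v (max 0 r) (max 0 r + 2 * max 0 x)" for x r
  have kc: "continuous_on UNIV (\<lambda>p. k (fst p) (snd p))"
    and kv: "\<And>x r. 0 \<le> x \<Longrightarrow> 0 \<le> r \<Longrightarrow> k x r = v r (r + 2 * x)"
    and ke: "\<And>x r. 0 \<le> x \<Longrightarrow> 0 \<le> r \<Longrightarrow> k x r = - ((1/2) *\<^sub>R integral {r/2..r/2 + x} q)
      - (1/2) *\<^sub>R integral {0..r} (\<lambda>\<rho>. integral {(r - \<rho>)/2..(r - \<rho>)/2 + x} (\<lambda>y. q y ** k y \<rho>))"
    unfolding k_def using goursat_solution_characteristic[OF \<open>goursat_solution q v\<close>] by blast+
  define U where "U j x t = wave_map k T (G j) x t" for j x t
  define u where "u = wave (kernel_w v) f"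
  have uU: "u x t = U 1 x t" if "x \<ge> 0" "t \<le> T" for x t
    unfolding u_def U_def by (rule wave_eq_wave_map) (use kv Gf Gz that in auto)
  have Uc: "continuous_on UNIV (\<lambda>p. U j (fst p) (snd p))" if "j \<le> 3" for j
    unfolding U_def by (rule continuous_on_wave_map[OF kc Gc[OF that]])
  have Ut: "continuous_on S (\<lambda>x. U j x t)" if "j \<le> 3" for j t S
    by (intro continuous_on_curried[OF Uc[OF that]] continuous_intros)
  have Uz: "U j x t = 0" if "j \<le> 3" "t \<le> x" for j x t
    unfolding U_def by (rule wave_map_eq_0) (use Gz that in auto)
  have UL2: "(\<lambda>x. U j x t) \<in> L2" if "j \<le> 3" for j t
    by (rule L2_of_continuous_bounded_support[of _ t]) (use Ut Uz that in auto)
  have dU: "has_L2_derivative (\<lambda>s x. U j x s) (\<lambda>x. U (Suc j) x t) t S" if "j < 3" "S \<subseteq> {0..T}" "t \<in> S" for j t S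
  proof (rule has_L2_derivative_of_pointwise[OF less_imp_le[OF T] that(2,3)])
    show "continuous_on UNIV (\<lambda>p. U (Suc j) (fst p) (snd p))" using Uc[of "Suc j"] that by simp
    show "(U j x has_vector_derivative U (Suc j) x t) (at t)" for x t
      unfolding U_def using that by (intro has_vector_derivative_wave_map kc G Gc) auto
  qed (use that Uz in auto)
  \<comment> \<open>\<open>U 3\<close> is the second time derivative of u, so this is what u_xx has
    to equal.\<close>
  define g where "g t x = U 3 x t + q x *v U 1 x t" for t x
  have gL1: "L1_loc (g t)" for t
    unfolding L1_loc_def
  proof (intro allI impI)
    fix R :: real assume "R > 0"
    then have "q absolutely_integrable_on {0..R}" using q by (simp add: L1_loc_def)
    then have "(\<lambda>x. q x *v U 1 x t) absolutely_integrable_on {0..R}"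
      by (rule absolutely_integrable_matrix_vector_mult_continuous) (simp add: Ut)
    moreover have "(\<lambda>x. U 3 x t) absolutely_integrable_on {0..R}"
      by (intro absolutely_integrable_continuous_real Ut) simp
    ultimately show "g t absolutely_integrable_on {0..R}"
      unfolding g_def[abs_def] by (intro set_integral_add(1))
  qed
  have ueq: "u x t = G 1 t + x *\<^sub>R (- G 2 t - integral {0..T} (\<lambda>y. q y *v U 1 y (t - y))) +
      integral {0..x} (\<lambda>y. (x - y) *\<^sub>R g t y)" if "t \<in> {0..T}" "x \<ge> 0" for x t
    unfolding g_def U_def using wave_map_integral_equation[where G=G and k=k and q=q, OF q kc ke T Gz G Gc, of t x] uU[of x t] that
    by (simp add: U_def)
  have W21: "(\<lambda>x. u x t) \<in> W21_loc" and dd: "AE x in lebesgue_on {0..}. dx (dx (\<lambda>x. u x t)) x = g t x"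
    if "t \<in> {0..T}" for t
    using W21_loc_of_integral_equation[OF gL1 ueq[OF that]] by auto
  have dom: "(\<lambda>x. u x t) \<in> Dom_Lmax q" if t: "t \<in> {0..T}" for t
  proof -
    have "(\<lambda>x. u x t) \<in> L2"
      using L2_cong[of "\<lambda>x. u x t" "\<lambda>x. U 1 x t"] UL2[of 1 t] uU t by simp
    \<comment> \<open>The product q u need not be square-integrable by itself; in -u_xx + q u it
      cancels, and the continuous function -u_tt, which vanishes for x > t, remains.\<close>
    moreover have "(\<lambda>x. - U 3 x t) \<in> L2"
      by (rule L2_of_continuous_bounded_support[of _ t]) (use Ut Uz in \<open>auto intro!: continuous_intros\<close>)
    then have "schroedinger q (\<lambda>x. u x t) \<in> L2"
    proof (rule L2_AE_cong)
      have "AE x in lebesgue_on {0..}. x \<in> {0::real..}" by (rule AE_I2) simp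
      then show "AE x in lebesgue_on {0..}. - U 3 x t = schroedinger q (\<lambda>x. u x t) x"
        using dd[OF t] by eventually_elim (use uU t in \<open>simp add: schroedinger_def g_def\<close>)
    qed
    ultimately show ?thesis using W21[OF t] by (simp add: Dom_Lmax_def)
  qed
  have "AE x in lebesgue_on {0..}. U 3 x t - dx (dx (\<lambda>x. u x t)) x + q x *v u x t = 0" if t: "t \<in> {0..T}" for t
  proof -
    have "AE x in lebesgue_on {0..}. x \<in> {0::real..}" by (rule AE_I2) simp
    then show ?thesis
      using dd[OF t] by eventually_elim (use uU t in \<open>simp add: g_def\<close>)
  qed
  moreover have "has_L2_derivative (\<lambda>s x. u x s) (\<lambda>x. U 2 x t) t {0..T}" if "t \<in> {0..<T}" for t
  proof (rule has_L2_derivative_cong)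
    show "has_L2_derivative (\<lambda>s x. U 1 x s) (\<lambda>x. U 2 x t) t {0..T}"
      using dU[of 1 "{0..T}" t] that by (simp add: numeral_2_eq_2)
  qed (use that uU in auto)
  moreover have "has_L2_derivative (\<lambda>t x. U 2 x t) (\<lambda>x. U 3 x t) t {0<..<T}" if "t \<in> {0<..<T}" for t
    using dU[of 2 "{0<..<T}" t] that by (auto simp: numeral_2_eq_2 numeral_3_eq_3 subset_iff)
  moreover have "AE x in lebesgue_on {0..}. U 2 x 0 = 0"
    by (rule AE_I2) (simp add: Uz)
  moreover have "u x 0 = 0" if "x \<ge> 0" for x
    using uU[OF that, of 0] T Uz[of 1 0 x] that by simp
  moreover have "u 0 t = f t" if "t \<in> {0..T}" for t
  proof -
    \<comment> \<open>At x = 0 the intervals of integration of q shrink to points, so the kernel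
      vanishes and only f(t) is left.\<close>
    have "k 0 r = 0" if "r \<ge> 0" for r
      using ke[of 0 r] that by simp
    then have "integral {0..T} (\<lambda>r. k 0 r *v G 1 (t - 0 - r)) = integral {0..T} (\<lambda>r. 0)"
      by (intro integral_cong) simp
    then show ?thesis using uU[of 0 t] that Gf[of t] by (simp add: U_def wave_map_def extend0_def)
  qed
  ultimately show ?thesis
    unfolding solves_system_def u_def[symmetric] using dom
    by (intro conjI exI[of _ "\<lambda>t x. U 2 x t"] exI[of _ "\<lambda>t x. U 3 x t"]) auto
qed

end
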